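(* In the multi-cell system described in the context, fix a cell $l$ and a real parameter $\gamma$. Consider the optimization problem over $\mathbf{A}_l\in\mathbb{C}^{M\times K}$ and $\alpha\in\mathbb{R}$: $$\text{minimize}_{\mathbf{A}_l,\alpha}\quad \mathbb{E}_{\mathbf{\tilde F}_{jl},\underline{z}_l,\underline{q}_l}\left[\left\|\alpha(\mathbf{F}_{ll}\mathbf{A}_{l}\underline{q}_l+\underline{z}_l)-\underline{q}_l\right\|^2 + \sum_{j\ne l} \left\|\alpha\gamma(\mathbf{F}_{jl}\mathbf{A}_{l}\underline{q}_l)\right\|^2 \right]\quad\text{subject to}\quad \operatorname{tr}\{\mathbf{A}_{l}^{\dagger}\mathbf{A}_{l}\}=1,$$ where the expectation is over the estimation errors $\mathbf{\tilde F}_{jl}$ ($1\le j\le L$), the noise $\underline{z}_l$ and the symbols $\underline{q}_l$, with the estimates $\mathbf{\hat F}_{jl}$ ($1\le j\le L$) held fixed. The optimal solution to this problem is $$\mathbf{A}_{l}^{opt} = \frac{1}{\alpha^{opt}}\left(\mathbf{\hat{F}}_{ll}^{\dagger}\mathbf{\hat{F}}_{ll}+\gamma^2\sum_{j\ne l} \mathbf{\hat{F}}_{jl}^{\dagger}\mathbf{\hat{F}}_{jl}+\eta\, \mathbf{I}_M\right)^{-1}\mathbf{\hat{F}}_{ll}^{\dagger},$$ where $$\eta=\delta_{ll}+\gamma^2\sum_{j\ne l}\delta_{jl}+K,$$ $$\delta_{jl} = p_f\operatorname{tr} \left\{\mathbf{D}_{jl}\left(\mathbf{I}_K + p_r \tau\,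 \mathbf{D}_{jl}^{1/2} \mathbf{\Psi}_j^{\dagger} \mathbf{\Lambda}_{jl}\mathbf{\Psi}_j\mathbf{D}_{jl}^{1/2}\right)^{-1}\right\},\qquad \mathbf{\Lambda}_{jl}=\left(\mathbf{I}_\tau+p_r \tau \sum_{i \ne j} \mathbf{\Psi}_i \mathbf{D}_{il} \mathbf{\Psi}_i^{\dagger}\right)^{-1},$$ and $\alpha^{opt}$ is such that $\operatorname{tr}\{(\mathbf{A}_{l}^{opt})^{\dagger} \mathbf{A}_{l}^{opt}\}=1$.
   Context: There are $L$ cells, each with one base station having $M$ antennas and $K\le M$ single-antenna users. Fix the average transmit powers $p_f$ (base station) and $p_r$ (user), a training length $\tau$ (a positive integer), and constants $\beta_{jlk}\ge 0$ ($1\le j,l\le L$, $1\le k\le K$). Let $\mathbf{D}_{jl}=\operatorname{diag}\{[\beta_{jl1}\ \cdots\ \beta_{jlK}]\}$. For $1\le j,l\le L$, $\mathbf{H}_{jl}$ is the $K\times M$ random matrix whose $(k,m)$ entry $h_{jlkm}$ is the fading coefficient between antenna $m$ of base station $l$ and user $k$ of cell $j$; all $h_{jlkm}$ are i.i.d. $\mathcal{CN}(0,1)$ (zero-mean circularly-symmetric complex Gaussian with variance 1). Uplink training: $\mathbf{\Psi}_j=[\underline{\psi}_{j1}\ \cdots\ \underline{\psi}_{jK}]$ is a $\tau\times K$ matrix of training vectors with $\underline{\psi}_{jk}^\dagger\underline{\psi}_{jk}=1$ ($\dagger$ is the Hermitian transpose). Base station $l$ observes the $\tau\times M$ matrix $\mathbf{Y}_l=\sqrt{p_r\tau}\sum_{j=1}^L\mathbf{\Psi}_j\mathbf{D}_{jl}^{1/2}\mathbf{H}_{jl}+\mathbf{W}_l$,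 where $\mathbf{W}_l$ is additive noise with i.i.d. $\mathcal{CN}(0,1)$ entries, independent of the $\mathbf{H}_{jl}$. The MMSE estimate of $\mathbf{H}_{jl}$ given $\mathbf{Y}_l$ is $\mathbf{\hat H}_{jl}=\sqrt{p_r\tau}\,\mathbf{D}_{jl}^{1/2}\mathbf{\Psi}_j^\dagger\left(\mathbf{I}_\tau+p_r\tau\sum_{i=1}^L\mathbf{\Psi}_i\mathbf{D}_{il}\mathbf{\Psi}_i^\dagger\right)^{-1}\mathbf{Y}_l$. Notation: $\mathbf{F}_{jl}=\sqrt{p_f}\,\mathbf{D}_{jl}^{1/2}\mathbf{H}_{jl}$, $\mathbf{\hat F}_{jl}=\sqrt{p_f}\,\mathbf{D}_{jl}^{1/2}\mathbf{\hat H}_{jl}$, $\mathbf{\tilde F}_{jl}=\mathbf{F}_{jl}-\mathbf{\hat F}_{jl}$. The symbol vector $\underline{q}_l\in\mathbb{C}^K$ satisfies $\mathbb{E}[\underline{q}_l]=\underline{0}$ and $\mathbb{E}[\underline{q}_l\underline{q}_l^\dagger]=\mathbf{I}_K$; the noise $\underline{z}_l\in\mathbb{C}^K$ has i.i.d. $\mathcal{CN}(0,1)$ entries; $\underline{q}_l$, $\underline{z}_l$ and the channel and training-noise matrices are mutually independent. $\mathbf{A}_l$ is the $M\times K$ linear precoding matrix of base station $l$. $\|\cdot\|$ is the two-norm, $\operatorname{tr}$ the trace, and $\mathbf{I}_n$ the $n\times n$ identity matrix. *)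

theory Defs
  imports "HOL-Probability.Probability"
begin

text \<open>
  Dimensions are types: \<open>'l\<close> indexes the \<open>L\<close> cells, \<open>'k\<close> the \<open>K\<close> users of a cell, \<open>'m\<close> the \<open>M\<close>
  antennas of a base station and \<open>'t\<close> the \<open>\<tau>\<close> training symbols.  A matrix of type
  \<open>complex ^ 'c ^ 'r\<close> has rows indexed by \<open>'r\<close> and columns indexed by \<open>'c\<close>.
\<close>

definition adj :: "complex ^ 'c ^ 'r \<Rightarrow> complex ^ 'r ^ 'c" where
  "adj A = (\<chi> i j. cnj (A $ j $ i))"

definition diag :: "('n \<Rightarrow> real) \<Rightarrow> complex ^ 'n ^ 'n" where
  "diag d = (\<chi> i j. if i = j then of_real (d i) else 0)"

text \<open>The law CN(0,1): the real and imaginary parts are independent and N(0,1/2).\<close>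

definition std_complex_normal :: "'w measure \<Rightarrow> ('w \<Rightarrow> complex) \<Rightarrow> bool" where
  "std_complex_normal P X \<longleftrightarrow>
     distributed P lborel (\<lambda>\<omega>. Re (X \<omega>)) (normal_density 0 (sqrt (1/2))) \<and>
     distributed P lborel (\<lambda>\<omega>. Im (X \<omega>)) (normal_density 0 (sqrt (1/2))) \<and>
     prob_space.indep_var P borel (\<lambda>\<omega>. Re (X \<omega>)) borel (\<lambda>\<omega>. Im (X \<omega>))"

text \<open>
  Fields: the probability space, \<open>p\<^sub>f\<close>, \<open>p\<^sub>r\<close>, \<open>\<beta>\<close>, \<open>\<Psi>\<close>, \<open>H\<close>, \<open>W\<close>, \<open>q\<close>, \<open>z\<close>.  In the two-index fields
  \<open>fading\<close> and \<open>channel\<close> the first index is the cell of the users and the second one the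
  base station.
\<close>

record ('w, 'l, 'k, 'm, 't) cell_system =
  pspace :: "'w measure"
  bs_power :: real
  user_power :: real
  fading :: "'l \<Rightarrow> 'l \<Rightarrow> 'k \<Rightarrow> real"
  training :: "'l \<Rightarrow> complex ^ 'k ^ 't"
  channel :: "'l \<Rightarrow> 'l \<Rightarrow> 'w \<Rightarrow> complex ^ 'm ^ 'k"
  train_noise :: "'l \<Rightarrow> 'w \<Rightarrow> complex ^ 'm ^ 't"
  symbols :: "'l \<Rightarrow> 'w \<Rightarrow> complex ^ 'k"
  rx_noise :: "'l \<Rightarrow> 'w \<Rightarrow> complex ^ 'k"

datatype source = Channels | Training_Noise | Symbols | Receiver_Noise

text \<open>The sigma-algebras generated by the four kinds of random quantities seen by cell \<open>l\<close>.\<close>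

fun source_events ::
  "('w, 'l::finite, 'k::finite, 'm::finite, 't::finite) cell_system \<Rightarrow> 'l \<Rightarrow> source \<Rightarrow> 'w set set"
where
  "source_events S l Channels =
     sets (vimage_algebra (space (pspace S)) (\<lambda>\<omega>. \<chi> i j. channel S i j \<omega>) borel)"
| "source_events S l Training_Noise =
     sets (vimage_algebra (space (pspace S)) (train_noise S l) borel)"
| "source_events S l Symbols =
     sets (vimage_algebra (space (pspace S)) (symbols S l) borel)"
| "source_events S l Receiver_Noise =
     sets (vimage_algebra (space (pspace S)) (rx_noise S l) borel)"

text \<open>
  In \<open>symbols_cov\<close> the Bochner integral of the matrix \<open>q q\<^sup>\<dagger>\<close> is nonzero, so \<open>q q\<^sup>\<dagger>\<close>, and with it
  \<open>q\<close>, is integrable; no separate integrability assumption is needed.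
\<close>

locale multicell_system = prob_space "pspace S"
  for S :: "('w, 'l::finite, 'k::finite, 'm::finite, 't::finite) cell_system" +
  assumes users_le_antennas: "CARD('k) \<le> CARD('m)"
    and bs_power_nonneg: "0 \<le> bs_power S"
    and user_power_nonneg: "0 \<le> user_power S"
    and fading_nonneg: "0 \<le> fading S j l k"
    and training_unit: "(adj (training S j) ** training S j) $ k $ k = 1"
    and channel_normal: "std_complex_normal (pspace S) (\<lambda>\<omega>. channel S j l \<omega> $ k $ m)"
    and channel_indep:
      "indep_vars (\<lambda>_. borel) (\<lambda>(j, l, k, m) \<omega>. channel S j l \<omega> $ k $ m) UNIV"
    and train_noise_normal: "std_complex_normal (pspace S) (\<lambda>\<omega>. train_noise S l \<omega> $ t $ m)"
    and train_noise_indep: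
      "indep_vars (\<lambda>_. borel) (\<lambda>(t, m) \<omega>. train_noise S l \<omega> $ t $ m) UNIV"
    and rx_noise_normal: "std_complex_normal (pspace S) (\<lambda>\<omega>. rx_noise S l \<omega> $ k)"
    and rx_noise_indep: "indep_vars (\<lambda>_. borel) (\<lambda>k \<omega>. rx_noise S l \<omega> $ k) UNIV"
    and symbols_measurable: "random_variable borel (symbols S l)"
    and symbols_mean: "expectation (symbols S l) = 0"
    and symbols_cov:
      "expectation (\<lambda>\<omega>. \<chi> i j. symbols S l \<omega> $ i * cnj (symbols S l \<omega> $ j)) =
        (mat 1 :: complex ^ 'k ^ 'k)"
    and sources_indep: "indep_sets (source_events S l) UNIV"

context
  fixes S :: "('w, 'l::finite, 'k::finite, 'm::finite, 't::finite) cell_system"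
begin

definition D :: "'l \<Rightarrow> 'l \<Rightarrow> complex ^ 'k ^ 'k" where
  "D j l = diag (fading S j l)"

definition D_half :: "'l \<Rightarrow> 'l \<Rightarrow> complex ^ 'k ^ 'k" where
  "D_half j l = diag (\<lambda>k. sqrt (fading S j l k))"

text \<open>\<open>p\<^sub>r \<tau>\<close>\<close>

definition train_energy :: real where
  "train_energy = user_power S * real CARD('t)"

definition observation :: "'l \<Rightarrow> 'w \<Rightarrow> complex ^ 'm ^ 't" where
  "observation l \<omega> =
     sqrt train_energy *\<^sub>R (\<Sum>j\<in>UNIV. training S j ** D_half j l ** channel S j l \<omega>)
       + train_noise S l \<omega>"

text \<open>The MMSE estimate of \<open>channel S j l\<close> given \<open>observation l\<close>.\<close>

definition Hhat :: "'l \<Rightarrow> 'l \<Rightarrow> 'w \<Rightarrow> complex ^ 'm ^ 'k" where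
  "Hhat j l \<omega> =
     sqrt train_energy *\<^sub>R
       (D_half j l ** adj (training S j)
         ** matrix_inv (mat 1 + train_energy *\<^sub>R
              (\<Sum>i\<in>UNIV. training S i ** D i l ** adj (training S i)))
         ** observation l \<omega>)"

definition F :: "'l \<Rightarrow> 'l \<Rightarrow> 'w \<Rightarrow> complex ^ 'm ^ 'k" where
  "F j l \<omega> = sqrt (bs_power S) *\<^sub>R (D_half j l ** channel S j l \<omega>)"

definition Fhat :: "'l \<Rightarrow> 'l \<Rightarrow> 'w \<Rightarrow> complex ^ 'm ^ 'k" where
  "Fhat j l \<omega> = sqrt (bs_power S) *\<^sub>R (D_half j l ** Hhat j l \<omega>)"

definition Ftilde :: "'l \<Rightarrow> 'l \<Rightarrow> 'w \<Rightarrow> complex ^ 'm ^ 'k" where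
  "Ftilde j l \<omega> = F j l \<omega> - Fhat j l \<omega>"

text \<open>
  The estimates are frozen at the values they take at the outcome \<open>\<omega>\<close>, while the estimation
  errors, the symbols and the receiver noise are averaged over \<open>\<omega>'\<close>: the channel inside the
  expectation is \<open>Fhat j l \<omega> + Ftilde j l \<omega>'\<close>.
\<close>

definition objective :: "'l \<Rightarrow> real \<Rightarrow> 'w \<Rightarrow> complex ^ 'k ^ 'm \<Rightarrow> real \<Rightarrow> real" where
  "objective l \<gamma> \<omega> A \<alpha> =
     (\<integral>\<omega>'.
        (norm (\<alpha> *\<^sub>R (((Fhat l l \<omega> + Ftilde l l \<omega>') ** A) *v symbols S l \<omega>' + rx_noise S l \<omega>')
                - symbols S l \<omega>'))\<^sup>2
        + (\<Sum>j\<in>UNIV - {l}.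
             (norm ((\<alpha> * \<gamma>) *\<^sub>R (((Fhat j l \<omega> + Ftilde j l \<omega>') ** A) *v symbols S l \<omega>')))\<^sup>2)
      \<partial>pspace S)"

definition optimal_precoder :: "'l \<Rightarrow> real \<Rightarrow> 'w \<Rightarrow> complex ^ 'k ^ 'm \<Rightarrow> real \<Rightarrow> bool" where
  "optimal_precoder l \<gamma> \<omega> A \<alpha> \<longleftrightarrow>
     is_arg_min (\<lambda>(A, \<alpha>). objective l \<gamma> \<omega> A \<alpha>) (\<lambda>(A, \<alpha>). trace (adj A ** A) = 1) (A, \<alpha>)"

definition Lam :: "'l \<Rightarrow> 'l \<Rightarrow> complex ^ 't ^ 't" where
  "Lam j l = matrix_inv (mat 1 + train_energy *\<^sub>R
     (\<Sum>i\<in>UNIV - {j}. training S i ** D i l ** adj (training S i)))"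

definition delta :: "'l \<Rightarrow> 'l \<Rightarrow> complex" where
  "delta j l = bs_power S *\<^sub>R
     trace (D j l ** matrix_inv (mat 1 + train_energy *\<^sub>R
       (D_half j l ** adj (training S j) ** Lam j l ** training S j ** D_half j l)))"

definition eta :: "'l \<Rightarrow> real \<Rightarrow> complex" where
  "eta l \<gamma> = delta l l + \<gamma>\<^sup>2 *\<^sub>R (\<Sum>j\<in>UNIV - {l}. delta j l) + of_nat CARD('k)"

text \<open>The closed-form precoder for a given scaling \<open>\<alpha>\<close>; note that \<open>mat c\<close> is \<open>c I\<close>.\<close>

definition A_opt :: "'l \<Rightarrow> real \<Rightarrow> 'w \<Rightarrow> real \<Rightarrow> complex ^ 'k ^ 'm" where
  "A_opt l \<gamma> \<omega> \<alpha> = (1 / \<alpha>) *\<^sub>R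
     (matrix_inv (adj (Fhat l l \<omega>) ** Fhat l l \<omega>
         + \<gamma>\<^sup>2 *\<^sub>R (\<Sum>j\<in>UNIV - {l}. adj (Fhat j l \<omega>) ** Fhat j l \<omega>)
         + mat (eta l \<gamma>))
       ** adj (Fhat l l \<omega>))"

end

end

theory Submission
  imports Defs
begin

text \<open>
  Put \<open>B = \<alpha> A\<close>.  Since \<open>E[q q\<^sup>\<dagger>] = I\<close> and the columns of each estimation error are uncorrelated with
  total power \<open>\<delta>\<^sub>j\<^sub>l\<close> per column, the expectation is \<open>\<parallel>Fhat\<^sub>l\<^sub>l B - I\<parallel>\<^sup>2 + \<gamma>\<^sup>2 \<Sum>\<^sub>j \<parallel>Fhat\<^sub>j\<^sub>l B\<parallel>\<^sup>2 +
  (\<delta>\<^sub>l\<^sub>l + \<gamma>\<^sup>2 \<Sum>\<^sub>j \<delta>\<^sub>j\<^sub>l) \<parallel>B\<parallel>\<^sup>2 + K \<alpha>\<^sup>2\<close> in Frobenius norms.  The constraint \<open>\<parallel>A\<parallel> = 1\<close> turns \<open>K \<alpha>\<^sup>2\<close> into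
  \<open>K \<parallel>B\<parallel>\<^sup>2\<close>, so that \<open>A\<close> and \<open>\<alpha>\<close> enter only through the unconstrained \<open>B\<close> of a strictly convex ridge
  regression.  The value of \<open>\<delta>\<^sub>j\<^sub>l\<close> comes from the matrix inversion lemma.
\<close>

section \<open>Complex matrices\<close>

lemma adj_nth [simp]: "adj A $ i $ j = cnj (A $ j $ i)"
  by (simp add: adj_def)

lemma adj_adj [simp]: "adj (adj A) = A"
  by (simp add: vec_eq_iff)

lemma adj_add: "adj (A + B) = adj A + adj B"
  by (simp add: vec_eq_iff)

lemma adj_diff: "adj (A - B) = adj A - adj B"
  by (simp add: vec_eq_iff)

lemma adj_scaleR: "adj (c *\<^sub>R A) = c *\<^sub>R adj A"
  by (simp add: vec_eq_iff)

lemma adj_sum: "adj (\<Sum>i\<in>I. A i) = (\<Sum>i\<in>I. adj (A i))"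
  by (simp add: vec_eq_iff)

lemma adj_mult: "adj (A ** B) = adj B ** adj A"
  by (simp add: vec_eq_iff matrix_matrix_mult_def mult.commute)

lemma adj_mat [simp]: "adj (mat c) = mat (cnj c)"
  by (simp add: vec_eq_iff mat_def)

lemma adj_zero [simp]: "adj 0 = 0"
  by (simp add: vec_eq_iff)

lemma adj_eq_0_iff [simp]: "adj A = 0 \<longleftrightarrow> A = 0"
  using adj_adj adj_zero by metis

lemma adj_diag [simp]: "adj (diag d) = diag d"
  by (simp add: vec_eq_iff diag_def)

lemma matrix_diff_distrib_left: "A ** (B - C) = A ** B - A ** (C :: 'a::ring_1^'n^'m)"
  by (simp add: vec_eq_iff matrix_matrix_mult_def right_diff_distrib sum_subtractf)

lemma matrix_diff_distrib_right: "(A - B) ** C = A ** C - B ** (C :: 'a::ring_1^'n^'m)"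
  by (simp add: vec_eq_iff matrix_matrix_mult_def left_diff_distrib sum_subtractf)

lemma matrix_add_distrib_right: "(A + B) ** C = A ** C + B ** (C :: 'a::semiring_1^'n^'m)"
  by (simp add: vec_eq_iff matrix_matrix_mult_def distrib_right sum.distrib)

lemma matrix_sum_distrib_left: "A ** (\<Sum>i\<in>I. B i) = (\<Sum>i\<in>I. A ** (B i :: 'a::semiring_1^'n^'m))"
  by (induction I rule: infinite_finite_induct) (simp_all add: matrix_add_ldistrib)

lemma matrix_sum_distrib_right: "(\<Sum>i\<in>I. B i) ** A = (\<Sum>i\<in>I. B i ** (A :: 'a::semiring_1^'n^'m))"
  by (induction I rule: infinite_finite_induct) (simp_all add: matrix_add_distrib_right)

lemma matrix_scaleR_left: "(c *\<^sub>R A) ** B = c *\<^sub>R (A ** (B :: 'a::real_algebra_1^'n^'m))"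
  by (simp add: scalar_matrix_assoc)

lemma matrix_scaleR_right: "A ** (c *\<^sub>R B) = c *\<^sub>R (A ** (B :: 'a::real_algebra_1^'n^'m))"
  by (simp add: matrix_scalar_ac scalar_matrix_assoc)

lemma mat_of_real_mult: "mat (of_real c) ** A = c *\<^sub>R (A :: complex^'n^'m)"
proof -
  have "mat (of_real c) = c *\<^sub>R (mat 1 :: complex^'m^'m)"
    by (simp add: vec_eq_iff mat_def scaleR_conv_of_real[where 'a = complex])
  then show ?thesis
    by (simp add: matrix_scaleR_left)
qed

lemmas matrix_distribs =
  matrix_add_ldistrib matrix_add_distrib_right matrix_diff_distrib_left matrix_diff_distrib_right
  matrix_sum_distrib_left matrix_sum_distrib_right matrix_scaleR_left matrix_scaleR_right

section \<open>Frobenius norm, trace and real inner product\<close>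

lemma norm_matrix_sq: "(norm A)\<^sup>2 = (\<Sum>i\<in>UNIV. \<Sum>j\<in>UNIV. (cmod (A $ i $ j))\<^sup>2)"
  by (simp add: norm_vec_def L2_set_def sum_nonneg)

text \<open>This lets quadratic forms in complex matrices be treated by real inner-product algebra,
  with \<open>adj\<close> as the adjoint.\<close>

lemma matrix_inner_eq_trace: "X \<bullet> Y = Re (trace (adj X ** Y))"
proof -
  have "trace (adj X ** Y) = (\<Sum>j\<in>UNIV. \<Sum>i\<in>UNIV. cnj (X $ i $ j) * Y $ i $ j)"
    by (simp add: trace_def matrix_matrix_mult_def)
  then show ?thesis
    by (subst (asm) sum.swap) (simp add: inner_vec_def inner_complex_def)
qed

lemma trace_adj_self: "trace (adj A ** A) = complex_of_real ((norm A)\<^sup>2)"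
proof -
  have "trace (adj A ** A) = (\<Sum>j\<in>UNIV. \<Sum>i\<in>UNIV. complex_of_real ((cmod (A $ i $ j))\<^sup>2))"
    by (simp add: trace_def matrix_matrix_mult_def complex_norm_square mult.commute[of "cnj _"]
        del: of_real_power)
  then show ?thesis
    by (subst (asm) sum.swap) (simp add: norm_matrix_sq)
qed

lemma sum_UNIV_sum_type:
  fixes f :: "'a::finite + 'b::finite \<Rightarrow> 'c::comm_monoid_add"
  shows "(\<Sum>s\<in>UNIV. f s) = (\<Sum>a\<in>UNIV. f (Inl a)) + (\<Sum>b\<in>UNIV. f (Inr b))"
  using sum.Plus[of UNIV UNIV f] by simp

lemma sum_UNIV_prod_type:
  fixes f :: "'a::finite \<times> 'b::finite \<Rightarrow> 'c::comm_monoid_add"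
  shows "(\<Sum>p\<in>UNIV. f p) = (\<Sum>a\<in>UNIV. \<Sum>b\<in>UNIV. f (a, b))"
  using sum.cartesian_product'[of f UNIV UNIV] by simp

lemma trace_sum: "trace (\<Sum>i\<in>I. A i) = (\<Sum>i\<in>I. trace (A i :: complex^'n^'n))"
  unfolding trace_def sum_component by (rule sum.swap)

lemma trace_scaleR: "trace (c *\<^sub>R A) = c *\<^sub>R trace (A :: complex^'n^'n)"
  by (simp add: trace_def scaleR_sum_right)

lemma trace_self_adj: "trace (A ** adj A) = complex_of_real ((norm A)\<^sup>2)"
  by (simp only: trace_mul_sym[of A] trace_adj_self)

lemma trace_adj_self_eq_1: "trace (adj A ** A) = 1 \<longleftrightarrow> norm A = 1"
proof -
  have "trace (adj A ** A) = 1 \<longleftrightarrow> complex_of_real ((norm A)\<^sup>2) = of_real 1"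
    by (simp only: trace_adj_self of_real_1)
  also have "\<dots> \<longleftrightarrow> norm A = 1"
    unfolding of_real_eq_iff using power2_eq_iff_nonneg[of "norm A" 1] by simp
  finally show ?thesis .
qed

lemma diag_mult_diag: "diag d ** diag e = diag (\<lambda>i. d i * e i)"
  by (simp add: vec_eq_iff diag_def matrix_matrix_mult_def if_distrib[of "\<lambda>x. x * _"] cong: if_cong)

lemma inner_adj_mult: "X \<bullet> (adj A ** Y) = (A ** X) \<bullet> Y"
  by (simp add: matrix_inner_eq_trace adj_mult matrix_mul_assoc)

section \<open>Inverses, coercivity and the matrix inversion lemma\<close>

lemma matrix_inv_works:
  assumes "invertible A"
  shows "A ** matrix_inv A = mat 1" "matrix_inv A ** A = mat 1"
  using someI_ex[OF assms[unfolded invertible_def]] unfolding matrix_inv_def by auto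

lemma matrix_inv_eqI:
  fixes A B :: "complex^'n^'n"
  assumes "A ** B = mat 1"
  shows "matrix_inv A = B"
proof -
  have "invertible A"
    using assms invertible_right_inverse by blast
  then have "matrix_inv A ** A = mat 1"
    by (rule matrix_inv_works)
  then show ?thesis
    using assms by (metis matrix_mul_assoc matrix_mul_lid matrix_mul_rid)
qed

text \<open>A quadratic form bounded below by a positive multiple of the squared norm leaves no room
  for a kernel, and a square matrix with trivial kernel is invertible.\<close>

lemma invertible_coercive:
  fixes N :: "complex^'n^'n"
  assumes "0 < c" and coercive: "\<And>X :: complex^'n^'n. c * (norm X)\<^sup>2 \<le> X \<bullet> (N ** X)"
  shows "invertible N"
proof -
  have "x = 0" if "N *v x = 0" for x
  proof -
    \<comment> \<open>Repeating the vector in every column gives a matrix to which the coercivity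
      bound applies.\<close>
    define X :: "complex^'n^'n" where "X = (\<chi> i j. x $ i)"
    have "N ** X = 0"
      using that by (simp add: X_def vec_eq_iff matrix_matrix_mult_def matrix_vector_mult_def)
    with coercive[of X] \<open>0 < c\<close> have "X = 0"
      by (simp add: mult_le_0_iff)
    then show "x = 0"
      by (simp add: X_def vec_eq_iff)
  qed
  then show ?thesis
    by (simp add: invertible_left_inverse matrix_left_invertible_ker)
qed

text \<open>Each Gram term adds a squared norm to the quadratic form, so the identity alone gives
  coercivity with constant 1. The index set is free because both the sum over all cells and the sum
  without one cell get inverted.\<close>

lemma invertible_one_plus_gram:
  fixes V :: "'i \<Rightarrow> complex^'k^'t"
  shows "invertible (mat 1 + (\<Sum>i\<in>I. V i ** adj (V i)))"
proof (rule invertible_coercive[of 1])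
  fix X :: "complex^'t^'t"
  have gram: "X \<bullet> (V i ** (adj (V i) ** X)) = (norm (adj (V i) ** X))\<^sup>2" for i
    using inner_adj_mult[of X "adj (V i)" "adj (V i) ** X"] by (simp add: power2_norm_eq_inner)
  have "X \<bullet> ((mat 1 + (\<Sum>i\<in>I. V i ** adj (V i))) ** X)
      = (norm X)\<^sup>2 + (\<Sum>i\<in>I. (norm (adj (V i) ** X))\<^sup>2)"
    by (simp add: matrix_distribs inner_add_right inner_sum_right gram power2_norm_eq_inner
        flip: matrix_mul_assoc)
  also have "\<dots> \<ge> (norm X)\<^sup>2"
    by (simp add: sum_nonneg)
  finally show "1 * (norm X)\<^sup>2 \<le> X \<bullet> ((mat 1 + (\<Sum>i\<in>I. V i ** adj (V i))) ** X)"
    by simp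
qed simp

text \<open>Taking adjoints makes \<open>adj B\<close> a left inverse of \<open>A\<close>, and a
  left and a right inverse agree.\<close>

lemma adj_inverse_self_adjoint:
  fixes A B :: "complex^'n^'n"
  assumes "A ** B = mat 1" "adj A = A"
  shows "adj B = B"
proof -
  have "adj B ** A = mat 1"
    using assms adj_mult[of A B] by simp
  then show ?thesis
    using assms(1) by (metis matrix_mul_assoc matrix_mul_lid matrix_mul_rid)
qed

text \<open>The matrix inversion lemma. It trades the inverse covariance of the full observation,
  which occurs in the estimator, for the inverse without one cell, which occurs in
  \<open>delta\<close> as \<open>Lam\<close>.\<close>

lemma woodbury:
  fixes V :: "complex^'k^'t" and N :: "complex^'t^'t"
  assumes inv: "invertible N" "invertible (N + V ** adj V)"
  shows "matrix_inv (mat 1 + adj V ** matrix_inv N ** V)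
       = mat 1 - adj V ** matrix_inv (N + V ** adj V) ** V"
proof (rule matrix_inv_eqI)
  define G where "G = matrix_inv N"
  define R where "R = matrix_inv (N + V ** adj V)"
  have GN: "G ** N = mat 1"
    unfolding G_def using inv(1) by (rule matrix_inv_works)
  have SR: "(N + V ** adj V) ** R = mat 1"
    unfolding R_def using inv(2) by (rule matrix_inv_works)
  \<comment> \<open>Multiplying the inverse relation for \<open>R\<close> by \<open>G\<close> from
    the left gives a resolvent identity. The product of the two claimed inverses differs from the
    identity by exactly the defect of this identity.\<close>
  have "G ** ((N + V ** adj V) ** R) = R + G ** V ** adj V ** R"
    by (simp add: matrix_distribs matrix_mul_assoc GN)
  then have G: "G = R + G ** V ** adj V ** R"
    by (simp add: SR)
  have "(mat 1 + adj V ** G ** V) ** (mat 1 - adj V ** R ** V)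
      = mat 1 + adj V ** (G - (R + G ** V ** adj V ** R)) ** V"
    by (simp add: matrix_distribs matrix_mul_assoc)
  then show "(mat 1 + adj V ** matrix_inv N ** V) ** (mat 1 - adj V ** matrix_inv (N + V ** adj V) ** V)
      = mat 1"
    unfolding G_def[symmetric] R_def[symmetric] using G by simp
qed

text \<open>The covariance, up to \<open>R\<close>, of the error of estimating the \<open>j\<close>-th white input of
  \<open>\<Sum>i. V i x\<^sub>i + w\<close>.\<close>

lemma error_covariance:
  fixes V :: "'i::finite \<Rightarrow> complex^'k^'t" and R :: "complex^'k^'n" and j :: 'i
  defines "C \<equiv> matrix_inv (mat 1 + (\<Sum>i\<in>UNIV. V i ** adj (V i)))"
  defines "P \<equiv> (\<lambda>i. R ** ((if i = j then mat 1 else 0) - adj (V j) ** C ** V i))"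
  defines "Q \<equiv> R ** adj (V j) ** C"
  shows "(\<Sum>i\<in>UNIV. P i ** adj (P i)) + Q ** adj Q
       = R ** (mat 1 - adj (V j) ** C ** V j) ** adj R"
proof -
  define G where "G = (\<Sum>i\<in>UNIV. V i ** adj (V i))"
  have inv: "(mat 1 + G) ** C = mat 1"
    unfolding C_def G_def using invertible_one_plus_gram matrix_inv_works by blast
  have "adj (mat 1 + G) = mat 1 + G"
    by (simp add: G_def adj_add adj_sum adj_mult)
  then have C: "adj C = C"
    using inv adj_inverse_self_adjoint by blast
  define U where "U = adj (V j) ** C"
  have adjU: "adj U = C ** V j"
    by (simp add: U_def adj_mult C)
  \<comment> \<open>The identity and the cross terms survive only for \<open>i = j\<close>; the
    quadratic term is there for every \<open>i\<close> and sums to \<open>G\<close>.\<close>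
  have "P i ** adj (P i) = R ** ((if i = j then mat 1 - U ** V j - adj (V j) ** adj U else 0)
      + U ** (V i ** adj (V i)) ** adj U) ** adj R" for i
    by (simp add: P_def U_def[symmetric] adj_diff adj_mult matrix_distribs matrix_mul_assoc)
  then have "(\<Sum>i\<in>UNIV. P i ** adj (P i)) = R ** (\<Sum>i\<in>UNIV.
      (if i = j then mat 1 - U ** V j - adj (V j) ** adj U else 0)
      + U ** (V i ** adj (V i)) ** adj U) ** adj R"
    by (simp only: matrix_sum_distrib_left matrix_sum_distrib_right)
  also have "(\<Sum>i\<in>UNIV. (if i = j then mat 1 - U ** V j - adj (V j) ** adj U else 0)
      + U ** (V i ** adj (V i)) ** adj U) = mat 1 - U ** V j - adj (V j) ** adj U + U ** G ** adj U"
    by (simp add: sum.distrib G_def matrix_sum_distrib_left matrix_sum_distrib_right)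
  finally have PP: "(\<Sum>i\<in>UNIV. P i ** adj (P i))
      = R ** (mat 1 - U ** V j - adj (V j) ** adj U + U ** G ** adj U) ** adj R" .
  have QQ: "Q ** adj Q = R ** (U ** adj U) ** adj R"
    by (simp add: Q_def U_def adj_mult matrix_mul_assoc)
  \<comment> \<open>Signal and noise terms join to \<open>U ** (mat 1 + G) ** C ** V j\<close>, and
    the inverse relation reduces this to \<open>U ** V j\<close>. Both cross terms equal that same
    matrix, so one of them is cancelled.\<close>
  have "U ** adj U + U ** G ** adj U = U ** (((mat 1 + G) ** C) ** V j)"
    unfolding adjU by (simp add: matrix_distribs matrix_mul_assoc)
  then have sandwich: "(mat 1 - U ** V j - adj (V j) ** adj U + U ** G ** adj U) + U ** adj U = mat 1 - U ** V j"
    unfolding inv adjU by (simp add: U_def matrix_mul_assoc algebra_simps)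
  then show ?thesis
    unfolding PP QQ matrix_add_ldistrib[symmetric] matrix_add_distrib_right[symmetric] sandwich
    by (simp add: U_def)
qed

section \<open>Ridge regression\<close>

text \<open>Least squares for \<open>G ** B = mat 1\<close> with a Tikhonov term. \<open>G\<close>
  will be the own-cell estimate, \<open>H j\<close> the estimates for the other cells, and
  \<open>B\<close> the precoder times its scaling.\<close>

definition regularized_error ::
  "complex^'m^'k \<Rightarrow> ('i \<Rightarrow> complex^'m^'n) \<Rightarrow> 'i set \<Rightarrow> real \<Rightarrow> real \<Rightarrow> complex^'k^'m \<Rightarrow> real" where
  "regularized_error G H J c \<eta> B =
     (norm (G ** B - mat 1))\<^sup>2 + c * (\<Sum>j\<in>J. (norm (H j ** B))\<^sup>2) + \<eta> * (norm B)\<^sup>2"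

text \<open>Completing the square: \<open>B0\<close> solves the normal equations, and the excess
  over its value is the quadratic form of \<open>N\<close> at \<open>B - B0\<close>, which is at
  least \<open>\<eta>\<close> times the squared distance. The single inequality yields both
  minimality and uniqueness.\<close>

lemma regularized_error_minimizer:
  fixes G :: "complex^'m^'k" and H :: "'i \<Rightarrow> complex^'m^'n" and J :: "'i set" and c \<eta> :: real
  assumes "0 \<le> c" "0 < \<eta>"
  defines "N \<equiv> adj G ** G + c *\<^sub>R (\<Sum>j\<in>J. adj (H j) ** H j) + mat (of_real \<eta>)"
  defines "B0 \<equiv> matrix_inv N ** adj G"
  shows "N ** B0 = adj G"
    and "regularized_error G H J c \<eta> B0 + \<eta> * (norm (B - B0))\<^sup>2 \<le> regularized_error G H J c \<eta> B"
proof -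
  have gram: "X \<bullet> (adj Z ** (Z ** X)) = (norm (Z ** X))\<^sup>2"
    for X :: "complex^'p^'m" and Z :: "complex^'m^'q"
    using inner_adj_mult[of X Z "Z ** X"] by (simp add: power2_norm_eq_inner)
  have form: "X \<bullet> (N ** X) = (norm (G ** X))\<^sup>2 + c * (\<Sum>j\<in>J. (norm (H j ** X))\<^sup>2) + \<eta> * (norm X)\<^sup>2"
    for X :: "complex^'p^'m"
    by (simp add: N_def matrix_distribs mat_of_real_mult inner_add_right inner_sum_right gram
        power2_norm_eq_inner[of X] flip: matrix_mul_assoc)
  have coercive: "\<eta> * (norm X)\<^sup>2 \<le> X \<bullet> (N ** X)" for X :: "complex^'p^'m"
    using \<open>0 \<le> c\<close> by (simp add: form sum_nonneg)
  have "invertible N"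
    using \<open>0 < \<eta>\<close> coercive by (rule invertible_coercive)
  then show NB0: "N ** B0 = adj G"
    by (simp add: B0_def matrix_mul_assoc matrix_inv_works)
  have N_adj: "adj N = N"
    by (simp add: N_def adj_add adj_mult adj_scaleR adj_sum)
  have expand: "regularized_error G H J c \<eta> B
      = B \<bullet> (N ** B) - 2 * (B \<bullet> adj G) + (norm (mat 1 :: complex^'k^'k))\<^sup>2" for B
    using inner_adj_mult[of B G "mat 1"]
    by (simp add: regularized_error_def form power2_norm_eq_inner inner_diff_left inner_diff_right
        inner_commute algebra_simps)
  \<comment> \<open>Since \<open>N\<close> is self-adjoint, both mixed terms equal
    \<open>B \<bullet> adj G\<close>, and the part linear in \<open>B - B0\<close> vanishes.\<close>
  have "B0 \<bullet> (N ** B) = B \<bullet> adj G"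
    using inner_adj_mult[of B0 N B] by (simp add: N_adj NB0 inner_commute)
  then have "regularized_error G H J c \<eta> B
      = regularized_error G H J c \<eta> B0 + (B - B0) \<bullet> (N ** (B - B0))"
    by (simp add: expand NB0 matrix_diff_distrib_left inner_diff_left inner_diff_right)
  then show "regularized_error G H J c \<eta> B0 + \<eta> * (norm (B - B0))\<^sup>2 \<le> regularized_error G H J c \<eta> B"
    using coercive[of "B - B0"] by simp
qed

section \<open>Square-integrable complex random variables\<close>

lemma borel_measurable_cnj [measurable (raw)]:
  "f \<in> borel_measurable M \<Longrightarrow> (\<lambda>x. cnj (f x)) \<in> borel_measurable M"
  by (simp add: borel_measurable_complex_iff)

lemma borel_measurable_vec_nth [measurable (raw)]:
  fixes f :: "'a \<Rightarrow> 'b::euclidean_space ^ 'n"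
  shows "f \<in> borel_measurable N \<Longrightarrow> (\<lambda>x. f x $ i) \<in> borel_measurable N"
  by (erule measurable_compose) (intro borel_measurable_continuous_onI continuous_intros)

text \<open>The class is closed under linear combinations, and products of two members are
  integrable. Measurability is demanded separately because integrability of the squared modulus does
  not imply it.\<close>

definition sq_integrable :: "'a measure \<Rightarrow> ('a \<Rightarrow> complex) \<Rightarrow> bool" where
  "sq_integrable M f \<longleftrightarrow> f \<in> borel_measurable M \<and> integrable M (\<lambda>x. (cmod (f x))\<^sup>2)"

lemma sq_integrable_measurable: "sq_integrable M f \<Longrightarrow> f \<in> borel_measurable M"
  by (simp add: sq_integrable_def)

lemma sq_integrable_integrable_sq: "sq_integrable M f \<Longrightarrow> integrable M (\<lambda>x. (cmod (f x))\<^sup>2)"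
  by (simp add: sq_integrable_def)

lemma sq_integrable_cmult: "sq_integrable M f \<Longrightarrow> sq_integrable M (\<lambda>x. c * f x)"
  by (auto simp: sq_integrable_def norm_mult power_mult_distrib)

lemma sq_integrable_cnj: "sq_integrable M f \<Longrightarrow> sq_integrable M (\<lambda>x. cnj (f x))"
  by (auto simp: sq_integrable_def)

lemma sq_integrable_mult_cnj:
  assumes "sq_integrable M f" "sq_integrable M g"
  shows "integrable M (\<lambda>x. f x * cnj (g x))"
proof (rule Bochner_Integration.integrable_bound)
  show "integrable M (\<lambda>x. (cmod (f x))\<^sup>2 + (cmod (g x))\<^sup>2)"
    using assms by (auto simp: sq_integrable_def)
  show "(\<lambda>x. f x * cnj (g x)) \<in> borel_measurable M"
    using assms by (auto simp: sq_integrable_def)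
  have "a * b \<le> a\<^sup>2 + b\<^sup>2" if "0 \<le> a" "0 \<le> b" for a b :: real
    using sum_squares_bound[of a b] that mult_nonneg_nonneg[of a b] by linarith
  then show "AE x in M. norm (f x * cnj (g x)) \<le> norm ((cmod (f x))\<^sup>2 + (cmod (g x))\<^sup>2)"
    by (simp add: norm_mult)
qed

lemma sq_integrable_add:
  assumes "sq_integrable M f" "sq_integrable M g"
  shows "sq_integrable M (\<lambda>x. f x + g x)"
proof -
  have meas: "(\<lambda>x. f x + g x) \<in> borel_measurable M"
    using assms by (auto simp: sq_integrable_def)
  have "integrable M (\<lambda>x. (cmod (f x + g x))\<^sup>2)"
  proof (rule Bochner_Integration.integrable_bound)
    show "integrable M (\<lambda>x. 2 * (cmod (f x))\<^sup>2 + 2 * (cmod (g x))\<^sup>2)"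
      using assms by (auto simp: sq_integrable_def)
    show "(\<lambda>x. (cmod (f x + g x))\<^sup>2) \<in> borel_measurable M"
      using meas by measurable
    have "(cmod (a + b))\<^sup>2 \<le> 2 * (cmod a)\<^sup>2 + 2 * (cmod b)\<^sup>2" for a b
    proof -
      have "(cmod (a + b))\<^sup>2 \<le> (cmod a + cmod b)\<^sup>2"
        by (simp add: norm_triangle_ineq power_mono)
      then show ?thesis
        using sum_squares_bound[of "cmod a" "cmod b"] by (simp add: power2_sum)
    qed
    then show "AE x in M. norm ((cmod (f x + g x))\<^sup>2) \<le> norm (2 * (cmod (f x))\<^sup>2 + 2 * (cmod (g x))\<^sup>2)"
      by simp
  qed
  with meas show ?thesis
    by (simp add: sq_integrable_def)
qed

lemma sq_integrable_zero: "sq_integrable M (\<lambda>x. 0)"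
  by (simp add: sq_integrable_def)

lemma sq_integrable_sum:
  "(\<And>i. i \<in> I \<Longrightarrow> sq_integrable M (f i)) \<Longrightarrow> sq_integrable M (\<lambda>x. \<Sum>i\<in>I. f i x)"
  by (induction I rule: infinite_finite_induct) (simp_all add: sq_integrable_zero sq_integrable_add)

lemma integral_self_mult_cnj:
  "(\<integral>x. f x * cnj (f x) \<partial>M) = complex_of_real (\<integral>x. (cmod (f x))\<^sup>2 \<partial>M)"
proof -
  have "(\<lambda>x. f x * cnj (f x)) = (\<lambda>x. complex_of_real ((cmod (f x))\<^sup>2))"
    by (simp add: complex_norm_square del: of_real_power)
  then show ?thesis
    by (simp only: integral_complex_of_real)
qed

lemma integral_sum_mult_cnj:
  assumes "finite I" "finite J"
    and "\<And>i. i \<in> I \<Longrightarrow> sq_integrable M (f i)" "\<And>j. j \<in> J \<Longrightarrow> sq_integrable M (g j)"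
  shows "(\<integral>x. (\<Sum>i\<in>I. a i * f i x) * cnj (\<Sum>j\<in>J. b j * g j x) \<partial>M)
       = (\<Sum>i\<in>I. \<Sum>j\<in>J. a i * cnj (b j) * (\<integral>x. f i x * cnj (g j x) \<partial>M))"
proof -
  have "(\<Sum>i\<in>I. a i * f i x) * cnj (\<Sum>j\<in>J. b j * g j x)
      = (\<Sum>i\<in>I. \<Sum>j\<in>J. a i * cnj (b j) * (f i x * cnj (g j x)))" for x
    by (simp add: sum_product mult_ac)
  moreover have "integrable M (\<lambda>x. f i x * cnj (g j x))" if "i \<in> I" "j \<in> J" for i j
    using that assms by (simp add: sq_integrable_mult_cnj)
  ultimately show ?thesis
    by simp
qed

text \<open>Pythagoras in the space of square-integrable functions: the mixed term is twice the real
  part of one complex inner product.\<close>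

lemma integral_orthogonal_add:
  assumes f: "sq_integrable M f" and g: "sq_integrable M g" and orth: "(\<integral>x. f x * cnj (g x) \<partial>M) = 0"
  shows "(\<integral>x. (cmod (f x + g x))\<^sup>2 \<partial>M) = (\<integral>x. (cmod (f x))\<^sup>2 \<partial>M) + (\<integral>x. (cmod (g x))\<^sup>2 \<partial>M)"
proof -
  note [simp] = sq_integrable_mult_cnj[OF f g] sq_integrable_integrable_sq[OF f]
    sq_integrable_integrable_sq[OF g]
  have "(cmod (a + b))\<^sup>2 = (cmod a)\<^sup>2 + (cmod b)\<^sup>2 + 2 * Re (a * cnj b)" for a b
    unfolding cmod_power2 by (simp add: power2_eq_square algebra_simps)
  then have "(\<integral>x. (cmod (f x + g x))\<^sup>2 \<partial>M)
      = (\<integral>x. (cmod (f x))\<^sup>2 + (cmod (g x))\<^sup>2 + 2 * Re (f x * cnj (g x)) \<partial>M)"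
    by (simp only:)
  also have "\<dots> = (\<integral>x. (cmod (f x))\<^sup>2 \<partial>M) + (\<integral>x. (cmod (g x))\<^sup>2 \<partial>M)"
    by (simp add: orth del: times_complex.sel)
  finally show ?thesis .
qed

section \<open>Independence and moments on a probability space\<close>

context prob_space
begin

lemma sq_integrable_const: "sq_integrable M (\<lambda>x. c)"
  by (simp add: sq_integrable_def)

lemma sq_integrable_integrable: "sq_integrable M f \<Longrightarrow> integrable M f"
  using sq_integrable_mult_cnj[of M f "\<lambda>_. 1"] by (simp add: sq_integrable_const)

text \<open>The families \<open>E i\<close> may be larger than the events of \<open>X i\<close>, so
  independence of whole sources passes to any variables measurable with respect to them.\<close>

lemma indep_vars_of_indep_sets:
  assumes "indep_sets E I"
    and "\<And>i A. i \<in> I \<Longrightarrow> A \<in> sets (M' i) \<Longrightarrow> X i -` A \<inter> space M \<in> E i"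
    and "\<And>i \<omega>. i \<in> I \<Longrightarrow> \<omega> \<in> space M \<Longrightarrow> X i \<omega> \<in> space (M' i)"
  shows "indep_vars M' X I"
  unfolding indep_vars_def2
proof
  show "\<forall>i\<in>I. random_variable (M' i) (X i)"
    using assms by (force simp: measurable_def indep_sets_def)
  show "indep_sets (\<lambda>i. {X i -` A \<inter> space M |A. A \<in> sets (M' i)}) I"
    using assms(2) by (intro indep_sets_mono_sets[OF assms(1)]) auto
qed

lemma indep_vars_orthogonal:
  fixes X :: "'i \<Rightarrow> 'a \<Rightarrow> complex"
  assumes indep: "indep_vars (\<lambda>_. borel) X I" and ij: "i \<in> I" "j \<in> I" "i \<noteq> j"
    and int: "integrable M (X i)" "integrable M (X j)" and "expectation (X i) = 0"
  shows "expectation (\<lambda>\<omega>. X i \<omega> * cnj (X j \<omega>)) = 0"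
proof -
  \<comment> \<open>The conjugation is absorbed into the second variable, so that the product rule
    for independent variables applies.\<close>
  define Y where "Y = (\<lambda>k. if k = j then cnj else (\<lambda>x. x))"
  have "indep_vars (\<lambda>_. borel) (\<lambda>k \<omega>. Y k (X k \<omega>)) {i, j}"
    by (rule indep_vars_compose2[OF indep_vars_subset[OF indep]]) (use ij in \<open>auto simp: Y_def\<close>)
  then have "expectation (\<lambda>\<omega>. \<Prod>k\<in>{i, j}. Y k (X k \<omega>)) = (\<Prod>k\<in>{i, j}. expectation (\<lambda>\<omega>. Y k (X k \<omega>)))"
    by (rule indep_vars_lebesgue_integral[rotated]) (use int in \<open>auto simp: Y_def\<close>)
  then show ?thesis
    using assms by (simp add: Y_def)
qed

text \<open>Real and imaginary parts have mean 0 and variance 1/2 each, and the squared modulus adds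
  the two variances.\<close>

lemma
  assumes "std_complex_normal M X"
  shows std_complex_normal_sq_integrable: "sq_integrable M X"
    and std_complex_normal_expectation: "expectation X = 0"
    and std_complex_normal_second_moment: "expectation (\<lambda>\<omega>. (cmod (X \<omega>))\<^sup>2) = 1"
proof -
  have moments: "random_variable borel Y \<and> integrable M (\<lambda>\<omega>. (Y \<omega>)\<^sup>2) \<and> expectation Y = 0
      \<and> expectation (\<lambda>\<omega>. (Y \<omega>)\<^sup>2) = 1 / 2"
    if Y: "distributed M lborel Y (normal_density 0 (sqrt (1/2)))" for Y
  proof -
    have "random_variable borel Y"
      using distributed_measurable[OF Y] by simp
    moreover have "expectation Y = 0"
      using normal_distributed_expectation[OF _ Y] by simp
    moreover have "expectation (\<lambda>\<omega>. (Y \<omega>)\<^sup>2) = 1 / 2"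
      using normal_distributed_variance[OF _ Y] \<open>expectation Y = 0\<close> by (simp add: real_sqrt_divide power_divide)
    \<comment> \<open>A Bochner integral defaults to 0 on a non-integrable function, so the value
      1/2 proves integrability.\<close>
    moreover from this have "integrable M (\<lambda>\<omega>. (Y \<omega>)\<^sup>2)"
      using not_integrable_integral_eq[of M "\<lambda>\<omega>. (Y \<omega>)\<^sup>2"] by fastforce
    ultimately show ?thesis
      by blast
  qed
  have Re: "distributed M lborel (\<lambda>\<omega>. Re (X \<omega>)) (normal_density 0 (sqrt (1/2)))"
    and Im: "distributed M lborel (\<lambda>\<omega>. Im (X \<omega>)) (normal_density 0 (sqrt (1/2)))"
    using assms by (auto simp: std_complex_normal_def)
  note Re = moments[OF Re] and Im = moments[OF Im]
  show sq: "sq_integrable M X"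
    using Re Im by (simp add: sq_integrable_def cmod_power2 borel_measurable_complex_iff)
  show "expectation (\<lambda>\<omega>. (cmod (X \<omega>))\<^sup>2) = 1"
    using Re Im by (simp add: cmod_power2)
  show "expectation X = 0"
    using Re Im sq_integrable_integrable[OF sq] by (simp add: complex_eq_iff)
qed

end

section \<open>Independence of the sources\<close>

text \<open>The estimation error depends on channels and training noise jointly, so these two
  sources are merged into one block, labelled \<open>Channels\<close>; every other source is its own
  block.\<close>

fun training_group :: "source \<Rightarrow> source set" where
  "training_group Channels = {Channels, Training_Noise}"
| "training_group s = {s}"

context multicell_system
begin

abbreviation generated_by :: "('w \<Rightarrow> 'b::topological_space) \<Rightarrow> 'w measure" where
  "generated_by X \<equiv> vimage_algebra (space (pspace S)) X borel"

definition training_algebra :: "'l \<Rightarrow> 'w measure" where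
  "training_algebra l = sigma (space (pspace S))
     (source_events S l Channels \<union> source_events S l Training_Noise)"

lemma source_events_subset: "source_events S l s \<subseteq> Pow (space (pspace S))"
  by (cases s) (auto dest!: sets.sets_into_space)

lemma space_training_algebra [simp]: "space (training_algebra l) = space (pspace S)"
  by (simp add: training_algebra_def space_measure_of_conv)

lemma sets_training_algebra:
  "sets (training_algebra l) = sigma_sets (space (pspace S)) (\<Union>s\<in>{Channels, Training_Noise}. source_events S l s)"
  using source_events_subset by (simp add: training_algebra_def del: source_events.simps)

lemma measurable_generated_by: "X \<in> borel_measurable (generated_by X)"
  by (rule measurable_vimage_algebra1) simp

lemma channel_measurable_training:
  "(\<lambda>\<omega>. channel S i j \<omega> $ k $ m) \<in> borel_measurable (training_algebra l)"
proof -
  let ?H = "\<lambda>\<omega>. \<chi> i j. channel S i j \<omega>"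
  have "(\<lambda>\<omega>. ?H \<omega> $ i $ j $ k $ m) \<in> borel_measurable (generated_by ?H)"
    using measurable_generated_by[of ?H] by measurable
  moreover have "sets (generated_by ?H) \<subseteq> sets (training_algebra l)"
    unfolding sets_training_algebra by (auto intro: sigma_sets.Basic)
  ultimately show ?thesis
    using measurable_mono[of borel borel "generated_by ?H" "training_algebra l"] by auto
qed

lemma train_noise_measurable_training:
  "(\<lambda>\<omega>. train_noise S l \<omega> $ t $ m) \<in> borel_measurable (training_algebra l)"
proof -
  have "(\<lambda>\<omega>. train_noise S l \<omega> $ t $ m) \<in> borel_measurable (generated_by (train_noise S l))"
    using measurable_generated_by[of "train_noise S l"] by measurable
  moreover have "sets (generated_by (train_noise S l)) \<subseteq> sets (training_algebra l)"
    unfolding sets_training_algebra by (auto intro: sigma_sets.Basic)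
  ultimately show ?thesis
    using measurable_mono[of borel borel "generated_by (train_noise S l)" "training_algebra l"] by auto
qed

lemma channel_sq_integrable: "sq_integrable (pspace S) (\<lambda>\<omega>. channel S i j \<omega> $ k $ m)"
  using channel_normal by (rule std_complex_normal_sq_integrable)

lemma train_noise_sq_integrable: "sq_integrable (pspace S) (\<lambda>\<omega>. train_noise S l \<omega> $ t $ m)"
  using train_noise_normal by (rule std_complex_normal_sq_integrable)

lemma rx_noise_sq_integrable: "sq_integrable (pspace S) (\<lambda>\<omega>. rx_noise S l \<omega> $ k)"
  using rx_noise_normal by (rule std_complex_normal_sq_integrable)

text \<open>The merged training block, the symbols and the receiver noise are independent, so
  expectations of products with one factor from each block factorize. A missing factor may be
  replaced by the constant 1.\<close>

lemma
  fixes U V W :: "'w \<Rightarrow> complex"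
  assumes U: "U \<in> borel_measurable (training_algebra l)" "integrable (pspace S) U"
    and V: "V \<in> borel_measurable (generated_by (symbols S l))" "integrable (pspace S) V"
    and W: "W \<in> borel_measurable (generated_by (rx_noise S l))" "integrable (pspace S) W"
  shows integrable_mult3: "integrable (pspace S) (\<lambda>\<omega>. U \<omega> * V \<omega> * W \<omega>)"
    and expectation_mult3: "expectation (\<lambda>\<omega>. U \<omega> * V \<omega> * W \<omega>)
      = expectation U * expectation V * expectation W"
proof -
  let ?J = "{Channels, Symbols, Receiver_Noise}"
  define X where "X = (\<lambda>s. case s of Channels \<Rightarrow> U | Symbols \<Rightarrow> V | _ \<Rightarrow> W)"
  have indep: "indep_sets (\<lambda>g. sigma_sets (space (pspace S)) (\<Union>s\<in>training_group g. source_events S l s)) ?J"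
  proof (rule indep_sets_collect_sigma)
    show "indep_sets (source_events S l) (\<Union>g\<in>?J. training_group g)"
      using sources_indep by (rule indep_sets_mono_index[rotated]) simp
    \<comment> \<open>Passing from independent families to the sigma-algebras of their unions needs
      pi-systems.\<close>
    show "Int_stable (source_events S l s)" for s
      by (cases s) (auto simp: Int_stable_def)
    show "disjoint_family_on training_group ?J"
      by (auto simp: disjoint_family_on_def)
  qed
  have X: "indep_vars (\<lambda>_. borel) X ?J"
  proof (rule indep_vars_of_indep_sets[OF indep])
    fix g and A :: "complex set"
    assume "g \<in> ?J" "A \<in> sets borel"
    moreover have "U -` A \<inter> space (pspace S) \<in> sigma_sets (space (pspace S))
        (\<Union>s\<in>training_group Channels. source_events S l s)" if "A \<in> sets borel"
      using measurable_sets[OF U(1) that] by (simp add: sets_training_algebra del: source_events.simps)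
    moreover have "V -` A \<inter> space (pspace S) \<in> source_events S l Symbols" if "A \<in> sets borel"
      using measurable_sets[OF V(1) that] by simp
    moreover have "W -` A \<inter> space (pspace S) \<in> source_events S l Receiver_Noise" if "A \<in> sets borel"
      using measurable_sets[OF W(1) that] by simp
    ultimately show "X g -` A \<inter> space (pspace S)
        \<in> sigma_sets (space (pspace S)) (\<Union>s\<in>training_group g. source_events S l s)"
      by (auto simp: X_def simp del: source_events.simps)
  qed simp
  have int: "integrable (pspace S) (X g)" for g
    using U V W by (cases g) (simp_all add: X_def)
  have prod: "(\<Prod>g\<in>?J. X g \<omega>) = U \<omega> * V \<omega> * W \<omega>" for \<omega>
    by (simp add: X_def mult.assoc)
  show "integrable (pspace S) (\<lambda>\<omega>. U \<omega> * V \<omega> * W \<omega>)"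
    using indep_vars_integrable[OF _ X int] by (simp add: prod)
  show "expectation (\<lambda>\<omega>. U \<omega> * V \<omega> * W \<omega>) = expectation U * expectation V * expectation W"
    using indep_vars_lebesgue_integral[OF _ X int] by (simp add: prod) (simp add: X_def mult.assoc)
qed

text \<open>The white noise from which \<open>Ftilde j l\<close> is formed, at antenna \<open>m\<close>.\<close>

definition excitation :: "'l \<Rightarrow> 'm \<Rightarrow> ('l \<times> 'k) + 't \<Rightarrow> 'w \<Rightarrow> complex" where
  "excitation l m s \<omega> = (case s of Inl (i, k) \<Rightarrow> channel S i l \<omega> $ k $ m
     | Inr t \<Rightarrow> train_noise S l \<omega> $ t $ m)"

lemma excitation_sq_integrable: "sq_integrable (pspace S) (excitation l m s)"
  by (cases s) (auto simp: excitation_def [abs_def] channel_sq_integrable train_noise_sq_integrable)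

lemma excitation_measurable: "excitation l m s \<in> borel_measurable (training_algebra l)"
  by (cases s) (auto simp: excitation_def [abs_def] channel_measurable_training
      train_noise_measurable_training)

lemma excitation_expectation: "expectation (excitation l m s) = 0"
  by (cases s) (auto simp: excitation_def [abs_def]
      std_complex_normal_expectation[OF channel_normal]
      std_complex_normal_expectation[OF train_noise_normal])

text \<open>The two entries come from different sources, so their expectations multiply, and the
  channel has mean 0.\<close>

lemma channel_train_noise_uncorrelated:
  "expectation (\<lambda>\<omega>. channel S i l \<omega> $ k $ m * cnj (train_noise S l \<omega> $ t $ n)) = 0"
proof -
  define X where "X = (\<lambda>b. if b = Channels then (\<lambda>\<omega>. channel S i l \<omega> $ k $ m)
    else (\<lambda>\<omega>. cnj (train_noise S l \<omega> $ t $ n)))"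
  let ?J = "{Channels, Training_Noise}" and ?H = "\<lambda>\<omega>. \<chi> i j. channel S i j \<omega>"
  have H: "(\<lambda>\<omega>. ?H \<omega> $ i $ l $ k $ m) \<in> borel_measurable (generated_by ?H)"
    using measurable_generated_by[of ?H] by measurable
  have T: "(\<lambda>\<omega>. cnj (train_noise S l \<omega> $ t $ n)) \<in> borel_measurable (generated_by (train_noise S l))"
    using measurable_generated_by[of "train_noise S l"] by measurable
  have "indep_vars (\<lambda>_. borel) X ?J"
  proof (rule indep_vars_of_indep_sets)
    show "indep_sets (source_events S l) ?J"
      using sources_indep by (rule indep_sets_mono_index[rotated]) simp
    fix s and A :: "complex set"
    assume "s \<in> ?J" "A \<in> sets borel"
    then show "X s -` A \<inter> space (pspace S) \<in> source_events S l s"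
      using measurable_sets[OF H] measurable_sets[OF T] by (auto simp: X_def)
  qed simp
  moreover have "integrable (pspace S) (X s)" for s
    by (simp add: X_def sq_integrable_integrable channel_sq_integrable sq_integrable_cnj
        train_noise_sq_integrable)
  ultimately have "expectation (\<lambda>\<omega>. \<Prod>s\<in>?J. X s \<omega>) = (\<Prod>s\<in>?J. expectation (X s))"
    by (intro indep_vars_lebesgue_integral) auto
  then show ?thesis
    by (simp add: X_def std_complex_normal_expectation[OF channel_normal])
qed

text \<open>Distinct entries of one kind are orthogonal by entrywise independence, entries of
  different kinds by independence of the sources. Equal entries have unit variance.\<close>

lemma excitation_white:
  "expectation (\<lambda>\<omega>. excitation l m s \<omega> * cnj (excitation l n s' \<omega>)) = of_bool (m = n \<and> s = s')"
proof (cases "m = n \<and> s = s'")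
  case True
  then have "expectation (\<lambda>\<omega>. excitation l m s \<omega> * cnj (excitation l n s' \<omega>))
      = of_real (expectation (\<lambda>\<omega>. (cmod (excitation l m s \<omega>))\<^sup>2))"
    by (simp add: integral_self_mult_cnj)
  also have "\<dots> = 1"
    by (cases s) (auto simp: excitation_def std_complex_normal_second_moment[OF channel_normal]
        std_complex_normal_second_moment[OF train_noise_normal])
  finally show ?thesis
    using True by simp
next
  case False
  have "expectation (\<lambda>\<omega>. excitation l m s \<omega> * cnj (excitation l n s' \<omega>)) = 0"
  proof (cases s; cases s')
    fix a b assume s: "s = Inl a" "s' = Inl b"
    obtain i k i' k' where ab: "a = (i, k)" "b = (i', k')"
      by (cases a, cases b) auto
    have "(i, l, k, m) \<noteq> (i', l, k', n)"
      using False s ab by auto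
    then show ?thesis
      using indep_vars_orthogonal[OF channel_indep, of "(i, l, k, m)" "(i', l, k', n)"]
      by (simp add: s ab excitation_def sq_integrable_integrable channel_sq_integrable
          std_complex_normal_expectation[OF channel_normal])
  next
    fix t t' assume s: "s = Inr t" "s' = Inr t'"
    have "(t, m) \<noteq> (t', n)"
      using False s by auto
    then show ?thesis
      using indep_vars_orthogonal[OF train_noise_indep, of "(t, m)" "(t', n)"]
      by (simp add: s excitation_def sq_integrable_integrable train_noise_sq_integrable
          std_complex_normal_expectation[OF train_noise_normal])
  next
    fix a t assume s: "s = Inl a" "s' = Inr t"
    show ?thesis
      by (cases a) (simp add: s excitation_def channel_train_noise_uncorrelated)
  next
    fix t b assume s: "s = Inr t" "s' = Inl b"
    obtain i k where b: "b = (i, k)"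
      by (cases b)
    \<comment> \<open>This mixed case is the complex conjugate of the other one.\<close>
    have "expectation (\<lambda>\<omega>. excitation l m s \<omega> * cnj (excitation l n s' \<omega>))
        = expectation (\<lambda>\<omega>. cnj (channel S i l \<omega> $ k $ n * cnj (train_noise S l \<omega> $ t $ m)))"
      by (simp add: s b excitation_def mult.commute)
    also have "\<dots> = 0"
      using channel_train_noise_uncorrelated[of i l k n t m]
      by (simp only: Bochner_Integration.integral_cnj complex_cnj_zero)
    finally show ?thesis .
  qed
  then show ?thesis
    using False by simp
qed

section \<open>The estimation error\<close>

lemma train_energy_nonneg: "0 \<le> train_energy S"
  by (simp add: train_energy_def user_power_nonneg)

lemma D_half_mult_D_half: "D_half S j l ** D_half S j l = D S j l"
  by (simp add: D_half_def D_def diag_mult_diag fading_nonneg)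

text \<open>The factor by which the channel of cell \<open>j\<close> enters the observation. With
  the training energy absorbed, the observation is the sum of
  \<open>pilot i l ** channel S i l \<omega>\<close> plus unit noise, the model of
  \<open>error_covariance\<close>.\<close>

definition pilot :: "'l \<Rightarrow> 'l \<Rightarrow> complex^'k^'t" where
  "pilot j l = sqrt (train_energy S) *\<^sub>R (training S j ** D_half S j l)"

definition observation_precision :: "'l \<Rightarrow> complex^'t^'t" where
  "observation_precision l = matrix_inv (mat 1 + (\<Sum>i\<in>UNIV. pilot i l ** adj (pilot i l)))"

definition scaling :: "'l \<Rightarrow> 'l \<Rightarrow> complex^'k^'k" where
  "scaling j l = sqrt (bs_power S) *\<^sub>R D_half S j l"

text \<open>The matrices \<open>P i\<close> of \<open>error_covariance\<close> with
  \<open>R = scaling j l\<close>; \<open>noise_weight\<close> is its \<open>Q\<close>, whose sign is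
  supplied by \<open>weight\<close>.\<close>

definition channel_weight :: "'l \<Rightarrow> 'l \<Rightarrow> 'l \<Rightarrow> complex^'k^'k" where
  "channel_weight j l i = scaling j l **
     ((if i = j then mat 1 else 0) - adj (pilot j l) ** observation_precision l ** pilot i l)"

definition noise_weight :: "'l \<Rightarrow> 'l \<Rightarrow> complex^'t^'k" where
  "noise_weight j l = scaling j l ** adj (pilot j l) ** observation_precision l"

definition weight :: "'l \<Rightarrow> 'l \<Rightarrow> 'k \<Rightarrow> ('l \<times> 'k) + 't \<Rightarrow> complex" where
  "weight j l k s = (case s of Inl (i, k') \<Rightarrow> channel_weight j l i $ k $ k'
     | Inr t \<Rightarrow> - noise_weight j l $ k $ t)"

text \<open>The variance of every entry in row \<open>k\<close> of the estimation error, since the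
  excitation is white and the weights do not depend on the antenna.\<close>

definition error_power :: "'l \<Rightarrow> 'l \<Rightarrow> 'k \<Rightarrow> real" where
  "error_power j l k = (\<Sum>s\<in>UNIV. (cmod (weight j l k s))\<^sup>2)"

lemma adj_D_half [simp]: "adj (D_half S j l) = D_half S j l"
  by (simp add: D_half_def)

lemma adj_scaling [simp]: "adj (scaling j l) = scaling j l"
  by (simp add: scaling_def adj_scaleR)

lemma adj_pilot: "adj (pilot j l) = sqrt (train_energy S) *\<^sub>R (D_half S j l ** adj (training S j))"
  by (simp add: pilot_def adj_scaleR adj_mult)

lemma pilot_gram:
  "pilot i l ** adj (pilot i l) = train_energy S *\<^sub>R (training S i ** D S i l ** adj (training S i))"
proof -
  have "pilot i l ** adj (pilot i l) = train_energy S *\<^sub>R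
      (training S i ** (D_half S i l ** D_half S i l) ** adj (training S i))"
    unfolding adj_pilot
    by (simp add: pilot_def matrix_scaleR_left matrix_scaleR_right matrix_mul_assoc train_energy_nonneg)
  then show ?thesis
    by (simp add: D_half_mult_D_half)
qed

lemma Ftilde_eq:
  "Ftilde S j l \<omega> = (\<Sum>i\<in>UNIV. channel_weight j l i ** channel S i l \<omega>) - noise_weight j l ** train_noise S l \<omega>"
proof -
  have "observation S l \<omega> = (\<Sum>i\<in>UNIV. pilot i l ** channel S i l \<omega>) + train_noise S l \<omega>"
    by (simp add: observation_def pilot_def matrix_scaleR_left scaleR_sum_right)
  moreover have "Hhat S j l \<omega> = adj (pilot j l) ** observation_precision l ** observation S l \<omega>"
    by (simp add: Hhat_def observation_precision_def pilot_gram scaleR_sum_right)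
      (simp add: adj_pilot matrix_scaleR_left)
  ultimately have "Ftilde S j l \<omega> = scaling j l ** (channel S j l \<omega> - adj (pilot j l)
      ** observation_precision l ** ((\<Sum>i\<in>UNIV. pilot i l ** channel S i l \<omega>) + train_noise S l \<omega>))"
    by (simp add: Ftilde_def F_def Fhat_def scaling_def matrix_scaleR_left matrix_diff_distrib_left
        scaleR_diff_right)
  \<comment> \<open>Writing the channel as a sum against a Kronecker delta merges it with the
    channel terms of the estimate.\<close>
  moreover have "channel S j l \<omega> = (\<Sum>i\<in>UNIV. (if i = j then mat 1 else 0) ** channel S i l \<omega>)"
    by (simp add: if_distrib[of "\<lambda>A. A ** _"] cong: if_cong)
  ultimately show ?thesis
    by (simp add: channel_weight_def noise_weight_def matrix_add_ldistrib matrix_sum_distrib_left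
        matrix_diff_distrib_left matrix_diff_distrib_right sum_subtractf matrix_mul_assoc)
qed

lemma Ftilde_nth:
  "Ftilde S j l \<omega> $ k $ m = (\<Sum>s\<in>UNIV. weight j l k s * excitation l m s \<omega>)"
  by (simp add: Ftilde_eq sum_UNIV_sum_type sum_UNIV_prod_type weight_def excitation_def
      matrix_matrix_mult_def sum_negf)

text \<open>The row variances add up to squared Frobenius norms of the weights, hence to the trace
  of the error covariance. \<open>error_covariance\<close> evaluates it, and \<open>woodbury\<close>
  brings it into the form of \<open>delta\<close>.\<close>

lemma sum_error_power: "complex_of_real (\<Sum>k\<in>UNIV. error_power j l k) = delta S j l"
proof -
  have trace_scaling: "trace (scaling j l ** X ** scaling j l) = bs_power S *\<^sub>R trace (D S j l ** X)" for X
  proof -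
    have "scaling j l ** (scaling j l ** X) = bs_power S *\<^sub>R ((D_half S j l ** D_half S j l) ** X)"
      by (simp add: scaling_def matrix_scaleR_left matrix_scaleR_right matrix_mul_assoc bs_power_nonneg)
    then show ?thesis
      by (simp only: trace_mul_sym[of "scaling j l ** X"] D_half_mult_D_half trace_scaleR)
  qed
  let ?V = "\<lambda>i. pilot i l" and ?N = "mat 1 + (\<Sum>i\<in>UNIV - {j}. pilot i l ** adj (pilot i l))"
  \<comment> \<open>Splitting off the pilot of cell \<open>j\<close> leaves the matrix whose inverse
    is \<open>Lam S j l\<close>.\<close>
  have full: "mat 1 + (\<Sum>i\<in>UNIV. ?V i ** adj (?V i)) = ?N + ?V j ** adj (?V j)"
    by (simp add: sum.remove[of UNIV j] add_ac)
  have "(\<Sum>k\<in>UNIV. error_power j l k)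
      = (\<Sum>i\<in>UNIV. (norm (channel_weight j l i))\<^sup>2) + (norm (noise_weight j l))\<^sup>2"
    unfolding error_power_def sum_UNIV_sum_type sum_UNIV_prod_type norm_matrix_sq
    by (simp add: weight_def sum.distrib) (rule sum.swap)
  then have "complex_of_real (\<Sum>k\<in>UNIV. error_power j l k)
      = trace ((\<Sum>i\<in>UNIV. channel_weight j l i ** adj (channel_weight j l i))
          + noise_weight j l ** adj (noise_weight j l))"
    by (simp add: trace_add trace_sum trace_self_adj)
  also have "\<dots> = trace (scaling j l ** (mat 1 - adj (?V j) ** observation_precision l ** ?V j) ** scaling j l)"
    using error_covariance[of "scaling j l" j ?V]
    by (simp add: channel_weight_def noise_weight_def observation_precision_def)
  also have "mat 1 - adj (?V j) ** observation_precision l ** ?V j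
      = matrix_inv (mat 1 + adj (?V j) ** matrix_inv ?N ** ?V j)"
    using woodbury[of ?N "?V j"] invertible_one_plus_gram[of ?V UNIV]
      invertible_one_plus_gram[of ?V "UNIV - {j}"]
    by (simp add: full observation_precision_def)
  also have "matrix_inv ?N = Lam S j l"
    by (simp add: Lam_def pilot_gram scaleR_sum_right)
  also have "adj (?V j) ** Lam S j l ** ?V j = train_energy S *\<^sub>R
      (D_half S j l ** adj (training S j) ** Lam S j l ** training S j ** D_half S j l)"
    unfolding adj_pilot
    by (simp add: pilot_def matrix_scaleR_left matrix_scaleR_right matrix_mul_assoc train_energy_nonneg)
  also have "trace (scaling j l ** matrix_inv (mat 1 + \<dots>) ** scaling j l) = delta S j l"
    by (simp add: delta_def trace_scaling)
  finally show ?thesis .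
qed

section \<open>Moments of the estimation error\<close>

lemma Ftilde_measurable: "(\<lambda>\<omega>. Ftilde S j l \<omega> $ k $ m) \<in> borel_measurable (training_algebra l)"
  unfolding Ftilde_nth using excitation_measurable by (intro borel_measurable_sum borel_measurable_times) auto

lemma Ftilde_sq_integrable: "sq_integrable (pspace S) (\<lambda>\<omega>. Ftilde S j l \<omega> $ k $ m)"
  unfolding Ftilde_nth by (intro sq_integrable_sum sq_integrable_cmult excitation_sq_integrable)

lemma Ftilde_expectation: "expectation (\<lambda>\<omega>. Ftilde S j l \<omega> $ k $ m) = 0"
  unfolding Ftilde_nth
  by (simp add: sq_integrable_integrable excitation_sq_integrable excitation_expectation)

lemma Ftilde_covariance:
  "expectation (\<lambda>\<omega>. Ftilde S j l \<omega> $ k $ m * cnj (Ftilde S j l \<omega> $ k $ n))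
   = (if m = n then of_real (error_power j l k) else 0)"
proof (cases "m = n")
  case True
  then show ?thesis
    unfolding Ftilde_nth
    by (subst integral_sum_mult_cnj)
      (simp_all add: excitation_sq_integrable excitation_white error_power_def complex_norm_square
        of_bool_def if_distrib[of "\<lambda>x. _ * x"] del: of_real_power cong: if_cong)
next
  case False
  then show ?thesis
    unfolding Ftilde_nth
    by (subst integral_sum_mult_cnj) (simp_all add: excitation_sq_integrable excitation_white)
qed

text \<open>The constant is orthogonal to the zero-mean error term, whose entries along a row are
  uncorrelated. In the application \<open>b\<close> is a column of the scaled precoder.\<close>

lemma affine_Ftilde_second_moment:
  "expectation (\<lambda>\<omega>. (cmod (c + (\<Sum>m\<in>UNIV. b m * Ftilde S j l \<omega> $ k $ m)))\<^sup>2)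
   = (cmod c)\<^sup>2 + error_power j l k * (\<Sum>m\<in>UNIV. (cmod (b m))\<^sup>2)"
proof -
  let ?Y = "\<lambda>\<omega>. \<Sum>m\<in>UNIV. b m * Ftilde S j l \<omega> $ k $ m"
  have Y: "sq_integrable (pspace S) ?Y"
    by (intro sq_integrable_sum sq_integrable_cmult Ftilde_sq_integrable)
  have EY: "expectation ?Y = 0"
    by (simp add: sq_integrable_integrable Ftilde_sq_integrable Ftilde_expectation)
  have "complex_of_real (expectation (\<lambda>\<omega>. (cmod (?Y \<omega>))\<^sup>2)) = expectation (\<lambda>\<omega>. ?Y \<omega> * cnj (?Y \<omega>))"
    by (simp only: integral_self_mult_cnj)
  also have "\<dots> = complex_of_real (error_power j l k * (\<Sum>m\<in>UNIV. (cmod (b m))\<^sup>2))"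
    by (subst integral_sum_mult_cnj)
      (simp_all add: Ftilde_sq_integrable Ftilde_covariance complex_norm_square sum_distrib_left
        if_distrib[of "\<lambda>x. _ * x"] mult_ac del: of_real_power cong: if_cong)
  finally have "expectation (\<lambda>\<omega>. (cmod (?Y \<omega>))\<^sup>2) = error_power j l k * (\<Sum>m\<in>UNIV. (cmod (b m))\<^sup>2)"
    by (simp only: of_real_eq_iff)
  moreover have "expectation (\<lambda>\<omega>. c * cnj (?Y \<omega>)) = 0"
    using EY by (simp del: cnj_sum complex_cnj_mult)
  ultimately show ?thesis
    using integral_orthogonal_add[OF sq_integrable_const Y] by (simp add: prob_space)
qed

section \<open>The expected objective\<close>

lemma
  shows symbols_sq_integrable: "sq_integrable (pspace S) (\<lambda>\<omega>. symbols S l \<omega> $ a)"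
    and symbols_covariance: "expectation (\<lambda>\<omega>. symbols S l \<omega> $ a * cnj (symbols S l \<omega> $ b)) = of_bool (a = b)"
proof -
  let ?Q = "\<lambda>\<omega>. (\<chi> i j. symbols S l \<omega> $ i * cnj (symbols S l \<omega> $ j)) :: complex^'k^'k"
  \<comment> \<open>A nonzero Bochner integral forces integrability; the diagonal entries then give
    square integrability of the symbols.\<close>
  have "expectation ?Q \<noteq> 0"
    unfolding symbols_cov by (auto simp: vec_eq_iff mat_def)
  then have Q: "integrable (pspace S) ?Q"
    using not_integrable_integral_eq by blast
  have entry: "bounded_linear (\<lambda>A :: complex^'k^'k. A $ i $ j)" for i j
    using bounded_linear_compose[OF bounded_linear_vec_nth bounded_linear_vec_nth] .
  have "expectation (\<lambda>\<omega>. ?Q \<omega> $ a $ b) = (mat 1 :: complex^'k^'k) $ a $ b"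
    using integral_bounded_linear[OF entry Q] by (simp add: symbols_cov)
  then show "expectation (\<lambda>\<omega>. symbols S l \<omega> $ a * cnj (symbols S l \<omega> $ b)) = of_bool (a = b)"
    by (simp add: mat_def)
  have "integrable (pspace S) (\<lambda>\<omega>. Re (?Q \<omega> $ a $ a))"
    by (intro integrable_Re integrable_bounded_linear[OF entry] Q)
  moreover have "Re (?Q \<omega> $ a $ a) = (cmod (symbols S l \<omega> $ a))\<^sup>2" for \<omega>
    by (simp add: complex_norm_square[symmetric] del: of_real_power times_complex.sel)
  moreover have "(\<lambda>\<omega>. symbols S l \<omega> $ a) \<in> borel_measurable (pspace S)"
    using symbols_measurable by measurable
  ultimately show "sq_integrable (pspace S) (\<lambda>\<omega>. symbols S l \<omega> $ a)"
    by (simp add: sq_integrable_def)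
qed

lemma symbols_measurable_generated:
  "(\<lambda>\<omega>. symbols S l \<omega> $ a) \<in> borel_measurable (generated_by (symbols S l))"
  using measurable_generated_by[of "symbols S l"] by measurable

lemma rx_noise_measurable_generated:
  "(\<lambda>\<omega>. rx_noise S l \<omega> $ k) \<in> borel_measurable (generated_by (rx_noise S l))"
  using measurable_generated_by[of "rx_noise S l"] by measurable

text \<open>One coordinate of the received signal, with random gains \<open>T a\<close> from the
  training block. White symbols make the summands orthogonal, and the zero-mean receiver noise is
  orthogonal to all of them.\<close>

lemma
  assumes T: "\<And>a. T a \<in> borel_measurable (training_algebra l)" "\<And>a. sq_integrable (pspace S) (T a)"
  shows received_row_sq_integrable:
      "sq_integrable (pspace S) (\<lambda>\<omega>. (\<Sum>a\<in>UNIV. T a \<omega> * symbols S l \<omega> $ a) + c * rx_noise S l \<omega> $ k)"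
    and received_row_second_moment:
      "expectation (\<lambda>\<omega>. (cmod ((\<Sum>a\<in>UNIV. T a \<omega> * symbols S l \<omega> $ a) + c * rx_noise S l \<omega> $ k))\<^sup>2)
       = (\<Sum>a\<in>UNIV. expectation (\<lambda>\<omega>. (cmod (T a \<omega>))\<^sup>2)) + (cmod c)\<^sup>2"
proof -
  let ?q = "\<lambda>a \<omega>. symbols S l \<omega> $ a" and ?z = "\<lambda>\<omega>. rx_noise S l \<omega> $ k"
  let ?Y = "\<lambda>\<omega>. \<Sum>a\<in>UNIV. T a \<omega> * ?q a \<omega>"
  note meas [measurable] = T(1) symbols_measurable_generated rx_noise_measurable_generated
  have Tq: "sq_integrable (pspace S) (\<lambda>\<omega>. T a \<omega> * ?q a \<omega>)" for a
  proof -
    have "integrable (pspace S)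
        (\<lambda>\<omega>. complex_of_real ((cmod (T a \<omega>))\<^sup>2) * complex_of_real ((cmod (?q a \<omega>))\<^sup>2) * 1)"
      by (rule integrable_mult3[of _ l])
        (use T(2) symbols_sq_integrable in \<open>auto intro!: sq_integrable_integrable_sq simp del: of_real_power\<close>)
    then have "integrable (pspace S) (\<lambda>\<omega>. complex_of_real ((cmod (T a \<omega> * ?q a \<omega>))\<^sup>2))"
      by (simp add: norm_mult power_mult_distrib)
    moreover have "(\<lambda>\<omega>. T a \<omega> * ?q a \<omega>) \<in> borel_measurable (pspace S)"
      using T(2) symbols_sq_integrable by (intro borel_measurable_times sq_integrable_measurable)
    ultimately show ?thesis
      by (simp only: sq_integrable_def complex_of_real_integrable_eq)
  qed
  have Y: "sq_integrable (pspace S) ?Y"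
    by (intro sq_integrable_sum Tq)
  have z: "sq_integrable (pspace S) (\<lambda>\<omega>. c * ?z \<omega>)"
    by (intro sq_integrable_cmult rx_noise_sq_integrable)
  show "sq_integrable (pspace S) (\<lambda>\<omega>. ?Y \<omega> + c * ?z \<omega>)"
    using Y z by (rule sq_integrable_add)
  have white: "expectation (\<lambda>\<omega>. (T a \<omega> * ?q a \<omega>) * cnj (T b \<omega> * ?q b \<omega>))
      = of_bool (a = b) * expectation (\<lambda>\<omega>. (cmod (T a \<omega>))\<^sup>2)" for a b
  proof -
    have "expectation (\<lambda>\<omega>. (T a \<omega> * cnj (T b \<omega>)) * (?q a \<omega> * cnj (?q b \<omega>)) * 1)
        = expectation (\<lambda>\<omega>. T a \<omega> * cnj (T b \<omega>)) * of_bool (a = b)"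
      by (subst expectation_mult3[of _ l])
        (use T(2) in \<open>auto intro!: sq_integrable_mult_cnj symbols_sq_integrable
          simp: symbols_covariance prob_space\<close>)
    moreover have "(T a \<omega> * ?q a \<omega>) * cnj (T b \<omega> * ?q b \<omega>)
        = (T a \<omega> * cnj (T b \<omega>)) * (?q a \<omega> * cnj (?q b \<omega>)) * 1" for \<omega>
      by (simp add: mult_ac)
    ultimately have "expectation (\<lambda>\<omega>. (T a \<omega> * ?q a \<omega>) * cnj (T b \<omega> * ?q b \<omega>))
        = expectation (\<lambda>\<omega>. T a \<omega> * cnj (T b \<omega>)) * of_bool (a = b)"
      by (simp only:)
    also have "\<dots> = of_bool (a = b) * expectation (\<lambda>\<omega>. (cmod (T a \<omega>))\<^sup>2)"
      by (cases "a = b") (simp_all add: integral_self_mult_cnj)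
    finally show ?thesis .
  qed
  have "complex_of_real (expectation (\<lambda>\<omega>. (cmod (?Y \<omega>))\<^sup>2)) = expectation (\<lambda>\<omega>. ?Y \<omega> * cnj (?Y \<omega>))"
    by (simp only: integral_self_mult_cnj)
  also have "\<dots> = (\<Sum>a\<in>UNIV. \<Sum>b\<in>UNIV. expectation (\<lambda>\<omega>. (T a \<omega> * ?q a \<omega>) * cnj (T b \<omega> * ?q b \<omega>)))"
    using integral_sum_mult_cnj[of UNIV UNIV "pspace S" "\<lambda>a \<omega>. T a \<omega> * ?q a \<omega>"
        "\<lambda>a \<omega>. T a \<omega> * ?q a \<omega>" "\<lambda>_. 1" "\<lambda>_. 1"] Tq
    by (simp only: finite mult_1_left mult_1_right complex_cnj_one)
  also have "\<dots> = complex_of_real (\<Sum>a\<in>UNIV. expectation (\<lambda>\<omega>. (cmod (T a \<omega>))\<^sup>2))"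
    unfolding white
    by (simp add: of_bool_def if_distrib[of complex_of_real] if_distrib[of "\<lambda>x. x * _"] cong: if_cong)
  finally have EY: "expectation (\<lambda>\<omega>. (cmod (?Y \<omega>))\<^sup>2) = (\<Sum>a\<in>UNIV. expectation (\<lambda>\<omega>. (cmod (T a \<omega>))\<^sup>2))"
    by (simp only: of_real_eq_iff)
  have orth: "expectation (\<lambda>\<omega>. ?Y \<omega> * cnj (c * ?z \<omega>)) = 0"
  proof -
    have "expectation (\<lambda>\<omega>. T a \<omega> * ?q a \<omega> * (cnj c * cnj (?z \<omega>))) = 0"
      and "integrable (pspace S) (\<lambda>\<omega>. T a \<omega> * ?q a \<omega> * (cnj c * cnj (?z \<omega>)))" for a
    proof -
      have cnj_z: "integrable (pspace S) (\<lambda>\<omega>. cnj c * cnj (?z \<omega>))"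
        by (intro sq_integrable_integrable sq_integrable_cmult sq_integrable_cnj rx_noise_sq_integrable)
      have "expectation (\<lambda>\<omega>. cnj c * cnj (?z \<omega>)) = 0"
        by (simp add: std_complex_normal_expectation[OF rx_noise_normal])
      then show "expectation (\<lambda>\<omega>. T a \<omega> * ?q a \<omega> * (cnj c * cnj (?z \<omega>))) = 0"
        by (subst expectation_mult3[of _ l])
          (use T(2) cnj_z in \<open>auto intro: sq_integrable_integrable symbols_sq_integrable\<close>)
      show "integrable (pspace S) (\<lambda>\<omega>. T a \<omega> * ?q a \<omega> * (cnj c * cnj (?z \<omega>)))"
        by (rule integrable_mult3[of _ l])
          (use T(2) cnj_z in \<open>auto intro: sq_integrable_integrable symbols_sq_integrable\<close>)
    qed
    then show ?thesis
      by (simp add: sum_distrib_right del: integrable_mult_left_iff)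
  qed
  have "expectation (\<lambda>\<omega>. (cmod (c * ?z \<omega>))\<^sup>2) = (cmod c)\<^sup>2"
    by (simp add: norm_mult power_mult_distrib std_complex_normal_second_moment[OF rx_noise_normal])
  then show "expectation (\<lambda>\<omega>. (cmod (?Y \<omega> + c * ?z \<omega>))\<^sup>2)
      = (\<Sum>a\<in>UNIV. expectation (\<lambda>\<omega>. (cmod (T a \<omega>))\<^sup>2)) + (cmod c)\<^sup>2"
    using integral_orthogonal_add[OF Y z orth] by (simp only: EY)
qed

text \<open>One shape serves both parts of the objective: \<open>X = mat 1\<close> and
  \<open>c = \<alpha>\<close> for the own cell, \<open>X = 0\<close> and \<open>c = 0\<close> for
  the others.\<close>

lemma
  fixes G :: "complex^'m^'k" and B :: "complex^'k^'m" and X :: "complex^'k^'k" and c :: real and j l :: 'l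
  defines "r \<equiv> (\<lambda>\<omega>. (((G + Ftilde S j l \<omega>) ** B) - X) *v symbols S l \<omega> + c *\<^sub>R rx_noise S l \<omega>)"
  shows received_integrable: "integrable (pspace S) (\<lambda>\<omega>. (norm (r \<omega>))\<^sup>2)"
    and received_second_moment: "expectation (\<lambda>\<omega>. (norm (r \<omega>))\<^sup>2)
      = (norm (G ** B - X))\<^sup>2 + (\<Sum>k\<in>UNIV. error_power j l k) * (norm B)\<^sup>2 + CARD('k) * c\<^sup>2"
proof -
  \<comment> \<open>An entry of the effective channel minus the target is affine in one row of the
    estimation error.\<close>
  let ?T = "\<lambda>k a \<omega>. (G ** B - X) $ k $ a + (\<Sum>m\<in>UNIV. B $ m $ a * Ftilde S j l \<omega> $ k $ m)"
  let ?row = "\<lambda>k \<omega>. (\<Sum>a\<in>UNIV. ?T k a \<omega> * symbols S l \<omega> $ a) + of_real c * rx_noise S l \<omega> $ k"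
  have row: "r \<omega> $ k = ?row k \<omega>" for k \<omega>
    by (simp add: r_def matrix_add_distrib_right matrix_vector_mult_def scaleR_conv_of_real[where 'a = complex])
      (simp add: matrix_matrix_mult_def mult.commute algebra_simps)
  have norm_r: "(norm (r \<omega>))\<^sup>2 = (\<Sum>k\<in>UNIV. (cmod (?row k \<omega>))\<^sup>2)" for \<omega>
    unfolding row[symmetric] by (simp add: norm_vec_def L2_set_def sum_nonneg)
  have meas: "?T k a \<in> borel_measurable (training_algebra l)" for k a
    by (intro borel_measurable_add borel_measurable_sum borel_measurable_times Ftilde_measurable) auto
  have sq: "sq_integrable (pspace S) (?T k a)" for k a
    by (intro sq_integrable_add sq_integrable_const sq_integrable_sum sq_integrable_cmult Ftilde_sq_integrable)
  have row_sq: "integrable (pspace S) (\<lambda>\<omega>. (cmod (?row k \<omega>))\<^sup>2)" for k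
    by (intro sq_integrable_integrable_sq received_row_sq_integrable meas sq)
  show "integrable (pspace S) (\<lambda>\<omega>. (norm (r \<omega>))\<^sup>2)"
    unfolding norm_r by (intro Bochner_Integration.integrable_sum row_sq)
  have "expectation (\<lambda>\<omega>. (norm (r \<omega>))\<^sup>2) = (\<Sum>k\<in>UNIV. expectation (\<lambda>\<omega>. (cmod (?row k \<omega>))\<^sup>2))"
    unfolding norm_r by (intro Bochner_Integration.integral_sum row_sq)
  also have "\<dots> = (\<Sum>k\<in>UNIV. (\<Sum>a\<in>UNIV. (cmod ((G ** B - X) $ k $ a))\<^sup>2
      + error_power j l k * (\<Sum>m\<in>UNIV. (cmod (B $ m $ a))\<^sup>2)) + c\<^sup>2)"
    by (intro sum.cong refl)
      (simp only: received_row_second_moment[OF meas sq] affine_Ftilde_second_moment norm_of_real power2_abs)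
  also have "\<dots> = (norm (G ** B - X))\<^sup>2
      + (\<Sum>k\<in>UNIV. error_power j l k) * (\<Sum>a\<in>UNIV. \<Sum>m\<in>UNIV. (cmod (B $ m $ a))\<^sup>2) + CARD('k) * c\<^sup>2"
    by (simp add: norm_matrix_sq sum.distrib sum_product)
  also have "(\<Sum>a\<in>UNIV. \<Sum>m\<in>UNIV. (cmod (B $ m $ a))\<^sup>2) = (norm B)\<^sup>2"
    unfolding norm_matrix_sq by (rule sum.swap)
  finally show "expectation (\<lambda>\<omega>. (norm (r \<omega>))\<^sup>2)
      = (norm (G ** B - X))\<^sup>2 + (\<Sum>k\<in>UNIV. error_power j l k) * (norm B)\<^sup>2 + CARD('k) * c\<^sup>2" .
qed

section \<open>From the objective to the ridge regression\<close>

definition ridge :: "'l \<Rightarrow> real \<Rightarrow> real" where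
  "ridge l \<gamma> = (\<Sum>k\<in>UNIV. error_power l l k)
     + \<gamma>\<^sup>2 * (\<Sum>j\<in>UNIV - {l}. \<Sum>k\<in>UNIV. error_power j l k) + CARD('k)"

text \<open>\<open>eta\<close> is a complex number because it is built from traces; its real
  counterpart \<open>ridge\<close> can serve as a regularization parameter.\<close>

lemma eta_eq_ridge: "eta S l \<gamma> = of_real (ridge l \<gamma>)"
  by (simp add: eta_def ridge_def sum_error_power[symmetric] scaleR_conv_of_real)

lemma ridge_pos: "0 < ridge l \<gamma>"
proof -
  have "0 \<le> (\<Sum>k\<in>UNIV. error_power j l k)" for j
    by (simp add: error_power_def sum_nonneg)
  then show ?thesis
    by (simp add: ridge_def add_nonneg_pos sum_nonneg)
qed

lemma objective_eq:
  assumes "norm A = 1"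
  shows "objective S l \<gamma> \<omega> A \<alpha>
    = regularized_error (Fhat S l l \<omega>) (\<lambda>j. Fhat S j l \<omega>) (UNIV - {l}) (\<gamma>\<^sup>2) (ridge l \<gamma>) (\<alpha> *\<^sub>R A)"
proof -
  let ?B = "\<alpha> *\<^sub>R A"
  let ?r = "\<lambda>\<omega>'. ((Fhat S l l \<omega> + Ftilde S l l \<omega>') ** ?B - mat 1) *v symbols S l \<omega>' + \<alpha> *\<^sub>R rx_noise S l \<omega>'"
  let ?s = "\<lambda>j \<omega>'. ((Fhat S j l \<omega> + Ftilde S j l \<omega>') ** (\<gamma> *\<^sub>R ?B) - 0) *v symbols S l \<omega>' + 0 *\<^sub>R rx_noise S l \<omega>'"
  have scaleR_vec: "c *\<^sub>R (M *v x) = (c *\<^sub>R M) *v x" for c and M :: "complex^'k^'k" and x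
    by (simp add: vec_eq_iff matrix_vector_mult_def scaleR_sum_right)
  have r: "\<alpha> *\<^sub>R (((Fhat S l l \<omega> + Ftilde S l l \<omega>') ** A) *v symbols S l \<omega>' + rx_noise S l \<omega>')
      - symbols S l \<omega>' = ?r \<omega>'" for \<omega>'
    by (simp add: matrix_scaleR_right scaleR_vec scaleR_add_right matrix_vector_mult_diff_rdistrib)
  have s: "(\<alpha> * \<gamma>) *\<^sub>R (((Fhat S j l \<omega> + Ftilde S j l \<omega>') ** A) *v symbols S l \<omega>') = ?s j \<omega>'" for j \<omega>'
    by (simp add: matrix_scaleR_right scaleR_vec mult.commute)
  have "objective S l \<gamma> \<omega> A \<alpha> = expectation (\<lambda>\<omega>'. (norm (?r \<omega>'))\<^sup>2)
      + (\<Sum>j\<in>UNIV - {l}. expectation (\<lambda>\<omega>'. (norm (?s j \<omega>'))\<^sup>2))"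
    unfolding objective_def r s
    by (subst Bochner_Integration.integral_add Bochner_Integration.integral_sum,
        (intro received_integrable Bochner_Integration.integrable_sum)+)+ (rule refl)
  also have "\<dots> = (norm (Fhat S l l \<omega> ** ?B - mat 1))\<^sup>2 + (\<Sum>k\<in>UNIV. error_power l l k) * (norm ?B)\<^sup>2
      + CARD('k) * \<alpha>\<^sup>2 + (\<Sum>j\<in>UNIV - {l}. (norm (Fhat S j l \<omega> ** (\<gamma> *\<^sub>R ?B)))\<^sup>2
          + (\<Sum>k\<in>UNIV. error_power j l k) * (norm (\<gamma> *\<^sub>R ?B))\<^sup>2)"
    unfolding received_second_moment by simp
  \<comment> \<open>The constraint enters here: for \<open>norm A = 1\<close>, the noise term
    \<open>CARD('k) * \<alpha>\<^sup>2\<close> equals \<open>CARD('k) * (norm ?B)\<^sup>2\<close>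
    and joins the ridge term.\<close>
  also have "\<dots> = regularized_error (Fhat S l l \<omega>) (\<lambda>j. Fhat S j l \<omega>) (UNIV - {l}) (\<gamma>\<^sup>2) (ridge l \<gamma>) ?B"
    using assms
    by (simp add: regularized_error_def ridge_def matrix_scaleR_right power_mult_distrib sum.distrib
        sum_distrib_left sum_distrib_right algebra_simps)
  finally show ?thesis .
qed

text \<open>Every feasible pair gives a matrix \<open>\<alpha> *\<^sub>R A\<close>, and the
  objective depends on that matrix alone, so optimality means hitting the unique ridge minimizer
  \<open>B\<close>. Both signs of \<open>\<alpha>\<close> with modulus \<open>norm B\<close> are
  optimal.\<close>

lemma optimal_precoder_iff:
  assumes "Fhat S l l \<omega> \<noteq> 0"
  shows "(\<exists>\<alpha>. norm (A_opt S l \<gamma> \<omega> \<alpha>) = 1)"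
    and "optimal_precoder S l \<gamma> \<omega> A \<alpha> \<longleftrightarrow> A = A_opt S l \<gamma> \<omega> \<alpha> \<and> norm (A_opt S l \<gamma> \<omega> \<alpha>) = 1"
proof -
  let ?f = "regularized_error (Fhat S l l \<omega>) (\<lambda>j. Fhat S j l \<omega>) (UNIV - {l}) (\<gamma>\<^sup>2) (ridge l \<gamma>)"
  let ?N = "adj (Fhat S l l \<omega>) ** Fhat S l l \<omega> + \<gamma>\<^sup>2 *\<^sub>R (\<Sum>j\<in>UNIV - {l}. adj (Fhat S j l \<omega>) ** Fhat S j l \<omega>)
    + mat (of_real (ridge l \<gamma>))"
  define B where "B = matrix_inv ?N ** adj (Fhat S l l \<omega>)"
  have "?N ** B = adj (Fhat S l l \<omega>)"
    unfolding B_def by (rule regularized_error_minimizer) (simp_all add: ridge_pos)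
  \<comment> \<open>If \<open>B\<close> were 0, the normal equation would make the own-cell estimate
    vanish.\<close>
  then have "B \<noteq> 0"
    using assms by auto
  have A_opt: "A_opt S l \<gamma> \<omega> \<alpha> = (1 / \<alpha>) *\<^sub>R B" for \<alpha>
    by (simp add: A_opt_def B_def eta_eq_ridge)
  have strict: "?f B + ridge l \<gamma> * (norm (X - B))\<^sup>2 \<le> ?f X" for X
    unfolding B_def by (rule regularized_error_minimizer) (simp_all add: ridge_pos)
  have le: "?f B \<le> ?f X" for X
    using strict[of X] ridge_pos[of l \<gamma>] by (smt (verit) mult_nonneg_nonneg zero_le_power2)
  have unique: "X = B" if "?f X \<le> ?f B" for X
  proof -
    have "ridge l \<gamma> * (norm (X - B))\<^sup>2 \<le> 0"
      using strict[of X] that by simp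
    then show ?thesis
      using ridge_pos[of l \<gamma>] by (simp add: mult_le_0_iff)
  qed
  have norm_B: "norm (A_opt S l \<gamma> \<omega> (norm B)) = 1"
    using \<open>B \<noteq> 0\<close> by (simp add: A_opt)
  then show "\<exists>\<alpha>. norm (A_opt S l \<gamma> \<omega> \<alpha>) = 1"
    by blast
  have optimal: "optimal_precoder S l \<gamma> \<omega> A \<alpha> \<longleftrightarrow> norm A = 1 \<and>
      (\<forall>A' \<alpha>'. norm A' = 1 \<longrightarrow> ?f (\<alpha> *\<^sub>R A) \<le> ?f (\<alpha>' *\<^sub>R A'))"
  proof -
    show ?thesis
      by (auto simp: optimal_precoder_def is_arg_min_linorder trace_adj_self_eq_1 objective_eq)
  qed
  show "optimal_precoder S l \<gamma> \<omega> A \<alpha> \<longleftrightarrow> A = A_opt S l \<gamma> \<omega> \<alpha> \<and> norm (A_opt S l \<gamma> \<omega> \<alpha>) = 1"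
  proof
    assume "optimal_precoder S l \<gamma> \<omega> A \<alpha>"
    \<comment> \<open>The normalized \<open>B\<close> with scaling \<open>norm B\<close> is a
      feasible competitor that attains the unconstrained minimum.\<close>
    then have "norm A = 1" and "?f (\<alpha> *\<^sub>R A) \<le> ?f (norm B *\<^sub>R A_opt S l \<gamma> \<omega> (norm B))"
      using optimal norm_B by blast+
    then have B: "\<alpha> *\<^sub>R A = B"
      using \<open>B \<noteq> 0\<close> by (intro unique) (simp add: A_opt)
    with \<open>B \<noteq> 0\<close> have "A = A_opt S l \<gamma> \<omega> \<alpha>"
      by (auto simp: A_opt)
    with \<open>norm A = 1\<close> show "A = A_opt S l \<gamma> \<omega> \<alpha> \<and> norm (A_opt S l \<gamma> \<omega> \<alpha>) = 1"
      by simp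
  next
    assume A: "A = A_opt S l \<gamma> \<omega> \<alpha> \<and> norm (A_opt S l \<gamma> \<omega> \<alpha>) = 1"
    \<comment> \<open>Division by 0 yields 0, so \<open>\<alpha> = 0\<close> would make the closed
      form the zero matrix, contradicting norm 1.\<close>
    then have "\<alpha> \<noteq> 0"
      by (auto simp: A_opt)
    with A have "\<alpha> *\<^sub>R A = B"
      by (simp add: A_opt)
    moreover have "norm A = 1"
      using A by simp
    ultimately show "optimal_precoder S l \<gamma> \<omega> A \<alpha>"
      using le by (simp add: optimal)
  qed
qed

end

text \<open>If the own-cell estimate were 0, the closed form would be 0 for every scaling and could
  not meet the power constraint; this is why it is assumed nonzero. Existence of a valid scaling
  together with the equivalence shows that minimizers exist and that all of them have the closed
  form.\<close>

theorem theorem5: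
  fixes S :: "('w, 'l::finite, 'k::finite, 'm::finite, 't::finite) cell_system"
    and l :: 'l and \<gamma> :: real and \<omega> :: 'w
  assumes "multicell_system S"
    and "\<omega> \<in> space (pspace S)"
    and "Fhat S l l \<omega> \<noteq> 0"
  shows "(\<exists>\<alpha>. trace (adj (A_opt S l \<gamma> \<omega> \<alpha>) ** A_opt S l \<gamma> \<omega> \<alpha>) = 1) \<and>
    (\<forall>A \<alpha>. optimal_precoder S l \<gamma> \<omega> A \<alpha> \<longleftrightarrow>
      A = A_opt S l \<gamma> \<omega> \<alpha> \<and> trace (adj (A_opt S l \<gamma> \<omega> \<alpha>) ** A_opt S l \<gamma> \<omega> \<alpha>) = 1)"
proof -
  interpret multicell_system S
    by fact
  show ?thesis
    using optimal_precoder_iff[OF assms(3)] by (simp add: trace_adj_self_eq_1)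
qed

end
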